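(* Let $p\ge 5$ be an odd integer and $q\ge 3$ an integer. For every cutoff layer $\Lambda\ge 0$, the $I_{p,q}$ tensor network of perfect tensors truncated at layer $\Lambda$ determines (with the normalization convention of the context) an isometry $u^\Lambda:\mathcal H^\Lambda_{code}\to\mathcal H^\Lambda_{phys}$ from the bulk (code) Hilbert space to the boundary (physical) Hilbert space.
   Context: Bourdon building. $I_{p,q}$ is the unique simply connected cellular 2-complex whose 2-cells (chambers, or tiles) are isometric to a regular right-angled hyperbolic $p$-gon, attached along edges and vertices, such that two distinct 2-cells share at most one edge or one vertex, and such that the link of every vertex is the complete bipartite graph $K(q,q)$. Each edge lies in exactly $q$ chambers. It is a building whose apartments are subcomplexes isometric to the tessellation of $\mathbb H^2$ by regular right-angled $p$-gons. Layers. Fix a central chamber $O$. The distance between chambers is the graph distance in the graph whose vertices are the chambers, two distinct chambers being joined when they share an edge. The layer of a chamber is its distance to $O$. Perfect tensor. A tensor with $2m$ indices, each of dimension $d\ge 2$, is perfect if for every splitting of its index set into $A\sqcup A^c$ with $|A|\le|A^c|$ it defines, up to a positive scalar, an isometry $(\mathbb C^d)^{\otimes A}\to(\mathbb C^d)^{\otimes A^c}$. Tensor network. Place in each chamber a perfect tensor with $(p+1)(q-1)$ legs of dimension $d$ (an even number since $p$ is odd; $d$ is chosen so that such a perfect tensor exists): $q-1$ of the legs are dangling (bulk) legs, and the other $p(q-1)$ legs correspond to the $p(q-1)$ chambers sharing an edge with the given chamber. For every two chambers sharing an edge, contract the two corresponding legs. Truncate at layer $\Lambda$: keep only the tensors in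 chambers of layer $\le\Lambda$; legs of kept tensors that would be contracted with chambers of layer $\Lambda+1$ become uncontracted boundary legs. $\mathcal H^\Lambda_{code}$ is the tensor product of copies of $\mathbb C^d$ over all dangling bulk legs of kept tensors; $\mathcal H^\Lambda_{phys}$ is the tensor product of copies of $\mathbb C^d$ over all boundary legs. The contracted network is a linear map $u^\Lambda:\mathcal H^\Lambda_{code}\to\mathcal H^\Lambda_{phys}$, considered up to an overall positive normalization constant, chosen so as to make it an isometry when it is proportional to one. *)

theory Defs
  imports "HOL-Analysis.Analysis"
begin

section \<open>Polygonal 2-complexes\<close>

text \<open>
  A cellular 2-complex all of whose 2-cells are \<open>p\<close>-gons. The boundary of a cell \<open>c\<close>
  is the cyclic sequence of vertices \<open>corner c 0, \<dots>, corner c (p - 1)\<close> and edges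
  \<open>side c 0, \<dots>, side c (p - 1)\<close>, where \<open>side c i\<close> joins \<open>corner c i\<close> to
  \<open>corner c (i + 1)\<close>, indices modulo \<open>p\<close>. Several edges may have the same end points.
  The metric is not recorded: for \<open>p \<ge> 5\<close> each cell carries the metric of the regular
  right-angled hyperbolic \<open>p\<close>-gon, which is unique up to isometry, and all the gluing
  maps are isometries between edges of the same length.
\<close>

record ('v, 'e, 'c) polygonal_complex =
  verts :: "'v set"
  edges :: "'e set"
  cells :: "'c set"
  ends :: "'e \<Rightarrow> 'v set"
  corner :: "'c \<Rightarrow> nat \<Rightarrow> 'v"
  side :: "'c \<Rightarrow> nat \<Rightarrow> 'e"

definition corners :: "nat \<Rightarrow> ('v, 'e, 'c) polygonal_complex \<Rightarrow> 'c \<Rightarrow> 'v set" where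
  "corners p X c = corner X c ` {..<p}"

definition sides :: "nat \<Rightarrow> ('v, 'e, 'c) polygonal_complex \<Rightarrow> 'c \<Rightarrow> 'e set" where
  "sides p X c = side X c ` {..<p}"

text \<open>Closed cells are embedded polygons, hence the injectivity of \<open>corner c\<close>.\<close>

definition polygonal :: "nat \<Rightarrow> ('v, 'e, 'c) polygonal_complex \<Rightarrow> bool" where
  "polygonal p X \<longleftrightarrow>
     (\<forall>e\<in>edges X. ends X e \<subseteq> verts X \<and> card (ends X e) = 2) \<and>
     (\<forall>c\<in>cells X.
        corners p X c \<subseteq> verts X \<and> sides p X c \<subseteq> edges X \<and>
        inj_on (corner X c) {..<p} \<and>
        (\<forall>i<p. ends X (side X c i) = {corner X c i, corner X c (Suc i mod p)}))"

definition small_intersections :: "nat \<Rightarrow> ('v, 'e, 'c) polygonal_complex \<Rightarrow> bool" where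
  "small_intersections p X \<longleftrightarrow>
     (\<forall>c\<in>cells X. \<forall>c'\<in>cells X. c \<noteq> c' \<longrightarrow>
        (sides p X c \<inter> sides p X c' = {} \<and>
           (corners p X c \<inter> corners p X c' = {} \<or>
            (\<exists>v. corners p X c \<inter> corners p X c' = {v}))) \<or>
        (\<exists>e. sides p X c \<inter> sides p X c' = {e} \<and>
             corners p X c \<inter> corners p X c' = ends X e))"


subsection \<open>Vertex links\<close>

text \<open>
  The nodes of the link of \<open>v\<close> are the edges at \<open>v\<close> (no edge is a loop, so each has
  only one end at \<open>v\<close>); its edges are the corners of cells at \<open>v\<close>, each joining the two
  sides of the cell that meet there.
\<close>

definition link_nodes :: "('v, 'e, 'c) polygonal_complex \<Rightarrow> 'v \<Rightarrow> 'e set" where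
  "link_nodes X v = {e \<in> edges X. v \<in> ends X e}"

definition link_adj :: "nat \<Rightarrow> ('v, 'e, 'c) polygonal_complex \<Rightarrow> 'v \<Rightarrow> 'e \<Rightarrow> 'e \<Rightarrow> bool" where
  "link_adj p X v e f \<longleftrightarrow>
     (\<exists>c\<in>cells X. \<exists>i<p. corner X c (Suc i mod p) = v \<and>
        {e, f} = {side X c i, side X c (Suc i mod p)})"

definition is_complete_bipartite :: "nat \<Rightarrow> 'n set \<Rightarrow> ('n \<Rightarrow> 'n \<Rightarrow> bool) \<Rightarrow> bool" where
  "is_complete_bipartite q N adj \<longleftrightarrow>
     (\<exists>A B. A \<inter> B = {} \<and> A \<union> B = N \<and> finite N \<and> card A = q \<and> card B = q \<and>
        (\<forall>x\<in>N. \<forall>y\<in>N. adj x y \<longleftrightarrow> (x \<in> A \<and> y \<in> B) \<or> (x \<in> B \<and> y \<in> A)))"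


subsection \<open>Simple connectedness\<close>

text \<open>
  The fundamental group of a 2-complex is computed by its edge paths, modulo insertion
  and deletion of backtracks and of boundary loops of 2-cells. A path is a list of
  oriented edges \<open>(a, e, b)\<close>, with \<open>e\<close> traversed from \<open>a\<close> to \<open>b\<close>.
\<close>

fun edge_path ::
  "('v, 'e, 'c) polygonal_complex \<Rightarrow> 'v \<Rightarrow> ('v \<times> 'e \<times> 'v) list \<Rightarrow> 'v \<Rightarrow> bool" where
  "edge_path X u [] v \<longleftrightarrow> u \<in> verts X \<and> u = v"
| "edge_path X u ((a, e, b) # ds) v \<longleftrightarrow>
     a = u \<and> e \<in> edges X \<and> ends X e = {a, b} \<and> edge_path X b ds v"

definition cell_loop ::
  "nat \<Rightarrow> ('v, 'e, 'c) polygonal_complex \<Rightarrow> 'c \<Rightarrow> nat \<Rightarrow> ('v \<times> 'e \<times> 'v) list" where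
  "cell_loop p X c i =
     map (\<lambda>j. (corner X c ((i + j) mod p), side X c ((i + j) mod p),
               corner X c (Suc (i + j) mod p))) [0..<p]"

text \<open>
  Boundary loops in the reverse orientation need not be listed: they are homotopic to the
  constant path by the two rules below.
\<close>

inductive elementary_homotopy ::
  "nat \<Rightarrow> ('v, 'e, 'c) polygonal_complex \<Rightarrow> 'v \<Rightarrow> 'v \<Rightarrow>
   ('v \<times> 'e \<times> 'v) list \<Rightarrow> ('v \<times> 'e \<times> 'v) list \<Rightarrow> bool"
  for p X u v where
  backtrack: "edge_path X u (xs @ [(a, e, b), (b, e, a)] @ ys) v \<Longrightarrow>
     elementary_homotopy p X u v (xs @ ys) (xs @ [(a, e, b), (b, e, a)] @ ys)"
| cell: "edge_path X u (xs @ cell_loop p X c i @ ys) v \<Longrightarrow> c \<in> cells X \<Longrightarrow> i < p \<Longrightarrow>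
     elementary_homotopy p X u v (xs @ ys) (xs @ cell_loop p X c i @ ys)"

definition homotopic_edge_paths ::
  "nat \<Rightarrow> ('v, 'e, 'c) polygonal_complex \<Rightarrow> 'v \<Rightarrow> 'v \<Rightarrow>
   ('v \<times> 'e \<times> 'v) list \<Rightarrow> ('v \<times> 'e \<times> 'v) list \<Rightarrow> bool" where
  "homotopic_edge_paths p X u v = equivclp (elementary_homotopy p X u v)"

definition simply_connected_complex :: "nat \<Rightarrow> ('v, 'e, 'c) polygonal_complex \<Rightarrow> bool" where
  "simply_connected_complex p X \<longleftrightarrow>
     (\<forall>u\<in>verts X. \<forall>v\<in>verts X. \<exists>ds. edge_path X u ds v) \<and>
     (\<forall>u\<in>verts X. \<forall>ds. edge_path X u ds u \<longrightarrow> homotopic_edge_paths p X u u ds [])"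


section \<open>The Bourdon building\<close>

text \<open>\<open>X\<close> is (a copy of) \<open>I\<^bsub>p,q\<^esub>\<close>.\<close>

definition bourdon_building :: "nat \<Rightarrow> nat \<Rightarrow> ('v, 'e, 'c) polygonal_complex \<Rightarrow> bool" where
  "bourdon_building p q X \<longleftrightarrow>
     polygonal p X \<and>
     small_intersections p X \<and>
     (\<forall>v\<in>verts X. is_complete_bipartite q (link_nodes X v) (link_adj p X v)) \<and>
     simply_connected_complex p X"

definition chamber_adj :: "nat \<Rightarrow> ('v, 'e, 'c) polygonal_complex \<Rightarrow> 'c \<Rightarrow> 'c \<Rightarrow> bool" where
  "chamber_adj p X c c' \<longleftrightarrow>
     c \<in> cells X \<and> c' \<in> cells X \<and> c \<noteq> c' \<and> sides p X c \<inter> sides p X c' \<noteq> {}"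

text \<open>Graph distance to \<open>c\<^sub>0\<close>; the chamber graph of a Bourdon building is connected.\<close>

definition layer :: "nat \<Rightarrow> ('v, 'e, 'c) polygonal_complex \<Rightarrow> 'c \<Rightarrow> 'c \<Rightarrow> nat" where
  "layer p X c0 c = (LEAST n. (chamber_adj p X ^^ n) c0 c)"


section \<open>Tensors and isometries\<close>

text \<open>
  \<open>configs d A\<close> indexes the product basis of the tensor product of copies of \<open>\<complex>\<^sup>d\<close> over
  the index set \<open>A\<close>. A vector of that space is given by its coefficient function on
  \<open>configs d A\<close>; values elsewhere are irrelevant. Likewise a tensor with index set \<open>I\<close> is
  its coefficient function on \<open>configs d I\<close>.
\<close>

definition configs :: "nat \<Rightarrow> 'i set \<Rightarrow> ('i \<Rightarrow> nat) set" where
  "configs d A = A \<rightarrow>\<^sub>E {..<d}"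

definition tnorm :: "nat \<Rightarrow> 'i set \<Rightarrow> (('i \<Rightarrow> nat) \<Rightarrow> complex) \<Rightarrow> real" where
  "tnorm d A \<psi> = L2_set (\<lambda>x. cmod (\<psi> x)) (configs d A)"

definition is_isometry ::
  "nat \<Rightarrow> 'i set \<Rightarrow> 'i set \<Rightarrow> ((('i \<Rightarrow> nat) \<Rightarrow> complex) \<Rightarrow> (('i \<Rightarrow> nat) \<Rightarrow> complex)) \<Rightarrow> bool"
  where
  "is_isometry d A B F \<longleftrightarrow>
     (\<forall>a b \<psi> \<phi>. \<forall>y\<in>configs d B. F (\<lambda>x. a * \<psi> x + b * \<phi> x) y = a * F \<psi> y + b * F \<phi> y) \<and>
     (\<forall>\<psi>. tnorm d B (F \<psi>) = tnorm d A \<psi>)"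

text \<open>
  The linear map defined by a tensor with index set \<open>A \<union> B\<close>, \<open>A\<close> and \<open>B\<close> disjoint, from
  the space over \<open>A\<close> (inputs) to the space over \<open>B\<close> (outputs).
\<close>

definition tensor_map ::
  "nat \<Rightarrow> 'i set \<Rightarrow> 'i set \<Rightarrow> (('i \<Rightarrow> nat) \<Rightarrow> complex) \<Rightarrow>
   (('i \<Rightarrow> nat) \<Rightarrow> complex) \<Rightarrow> (('i \<Rightarrow> nat) \<Rightarrow> complex)" where
  "tensor_map d A B T \<psi> y = (\<Sum>x\<in>configs d A. T (merge A B (x, y)) * \<psi> x)"

definition perfect_tensor :: "nat \<Rightarrow> 'i set \<Rightarrow> (('i \<Rightarrow> nat) \<Rightarrow> complex) \<Rightarrow> bool" where
  "perfect_tensor d I T \<longleftrightarrow>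
     finite I \<and> even (card I) \<and>
     (\<forall>A. A \<subseteq> I \<and> card A \<le> card (I - A) \<longrightarrow>
        (\<exists>\<kappa>>0. is_isometry d A (I - A)
                 (\<lambda>\<psi> y. complex_of_real \<kappa> * tensor_map d A (I - A) T \<psi> y)))"


section \<open>The truncated tensor network\<close>

text \<open>
  The legs of the tensor in a chamber: \<open>q - 1\<close> dangling ones, and one for each chamber
  sharing an edge with it.
\<close>

datatype 'c leg = Dangling nat | Toward 'c

definition legs :: "nat \<Rightarrow> nat \<Rightarrow> ('v, 'e, 'c) polygonal_complex \<Rightarrow> 'c \<Rightarrow> 'c leg set" where
  "legs p q X c = Dangling ` {..<q - 1} \<union> Toward ` {c'. chamber_adj p X c c'}"

text \<open>
  Wires of the truncated network: \<open>Bulk c k\<close> is the \<open>k\<close>-th dangling leg of \<open>c\<close>,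
  \<open>Bond {c, c'}\<close> is the contraction of the legs of \<open>c\<close> and \<open>c'\<close> toward each other, and
  \<open>Cut c c'\<close> is the boundary leg of \<open>c\<close> toward the discarded chamber \<open>c'\<close>.
\<close>

datatype 'c wire = Bulk 'c nat | Bond "'c set" | Cut 'c 'c

definition kept :: "nat \<Rightarrow> ('v, 'e, 'c) polygonal_complex \<Rightarrow> 'c \<Rightarrow> nat \<Rightarrow> 'c set" where
  "kept p X c0 \<Lambda> = {c \<in> cells X. layer p X c0 c \<le> \<Lambda>}"

definition bulk_wires ::
  "nat \<Rightarrow> nat \<Rightarrow> ('v, 'e, 'c) polygonal_complex \<Rightarrow> 'c \<Rightarrow> nat \<Rightarrow> 'c wire set" where
  "bulk_wires p q X c0 \<Lambda> = {Bulk c k |c k. c \<in> kept p X c0 \<Lambda> \<and> k < q - 1}"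

definition bond_wires ::
  "nat \<Rightarrow> ('v, 'e, 'c) polygonal_complex \<Rightarrow> 'c \<Rightarrow> nat \<Rightarrow> 'c wire set" where
  "bond_wires p X c0 \<Lambda> =
     {Bond {c, c'} |c c'. c \<in> kept p X c0 \<Lambda> \<and> c' \<in> kept p X c0 \<Lambda> \<and> chamber_adj p X c c'}"

definition boundary_wires ::
  "nat \<Rightarrow> ('v, 'e, 'c) polygonal_complex \<Rightarrow> 'c \<Rightarrow> nat \<Rightarrow> 'c wire set" where
  "boundary_wires p X c0 \<Lambda> =
     {Cut c c' |c c'. c \<in> kept p X c0 \<Lambda> \<and> chamber_adj p X c c' \<and> layer p X c0 c' = \<Lambda> + 1}"

fun wire_of ::
  "nat \<Rightarrow> ('v, 'e, 'c) polygonal_complex \<Rightarrow> 'c \<Rightarrow> nat \<Rightarrow> 'c \<Rightarrow> 'c leg \<Rightarrow> 'c wire" where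
  "wire_of p X c0 \<Lambda> c (Dangling k) = Bulk c k"
| "wire_of p X c0 \<Lambda> c (Toward c') =
     (if c' \<in> kept p X c0 \<Lambda> then Bond {c, c'} else Cut c c')"

text \<open>
  The contracted network, a tensor whose indices are the bulk and the boundary wires:
  the sum over all bond configurations \<open>z\<close> of the product of the local tensors.
\<close>

definition network_tensor ::
  "nat \<Rightarrow> nat \<Rightarrow> nat \<Rightarrow> ('v, 'e, 'c) polygonal_complex \<Rightarrow> 'c \<Rightarrow>
   ('c \<Rightarrow> ('c leg \<Rightarrow> nat) \<Rightarrow> complex) \<Rightarrow> nat \<Rightarrow> ('c wire \<Rightarrow> nat) \<Rightarrow> complex" where
  "network_tensor p q d X c0 T \<Lambda> t =
     (\<Sum>z\<in>configs d (bond_wires p X c0 \<Lambda>).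
        \<Prod>c\<in>kept p X c0 \<Lambda>.
          T c (\<lambda>l\<in>legs p q X c.
                 merge (bulk_wires p q X c0 \<Lambda> \<union> boundary_wires p X c0 \<Lambda>)
                       (bond_wires p X c0 \<Lambda>) (t, z) (wire_of p X c0 \<Lambda> c l)))"

text \<open>The map \<open>u\<^sup>\<Lambda>\<close> before normalization.\<close>

definition network_map ::
  "nat \<Rightarrow> nat \<Rightarrow> nat \<Rightarrow> ('v, 'e, 'c) polygonal_complex \<Rightarrow> 'c \<Rightarrow>
   ('c \<Rightarrow> ('c leg \<Rightarrow> nat) \<Rightarrow> complex) \<Rightarrow> nat \<Rightarrow>
   (('c wire \<Rightarrow> nat) \<Rightarrow> complex) \<Rightarrow> (('c wire \<Rightarrow> nat) \<Rightarrow> complex)" where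
  "network_map p q d X c0 T \<Lambda> =
     tensor_map d (bulk_wires p q X c0 \<Lambda>) (boundary_wires p X c0 \<Lambda>)
       (network_tensor p q d X c0 T \<Lambda>)"

end

theory Submission
  imports Defs
begin

text \<open>
  Galleries starting at \<open>c\<^sub>0\<close> are considered up to swaps of two consecutive steps around a vertex; a
  gallery is reduced if no swaps bring two steps across the same edge next to each other. A Levi lemma
  shows that the last steps that can occur in a swap class cross pairwise adjacent sides of the end
  chamber, so there are at most two of them. Swap classes of reduced galleries form a covering of the
  building; since it is simply connected, every chamber is the end of exactly one class, whose length
  gives its layer. Hence a chamber has at most \<open>2 (q - 1)\<close> of its \<open>p (q - 1)\<close> neighbours in layers
  not beyond its own. Contract the tensors in an order refining the layers: each has at most
  \<open>3 (q - 1)\<close> inputs, namely its bulk legs and the bonds to earlier tensors, among its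
  \<open>(p + 1) (q - 1)\<close> legs. As \<open>p \<ge> 5\<close> this is at most half of them, so each tensor acts as a multiple
  of an isometry, and so does the network.
\<close>

section \<open>Galleries up to swaps\<close>

text \<open>The hypotheses on links and intersections are local, while equality of the length of a
  reduced gallery with a graph distance is global. Simple connectedness has to bridge the two, and
  it is available only for edge paths in the complex. The covering is therefore never built as a
  complex: a lift of a vertex is a class of galleries under a relation \<open>vres\<close>, and only
  edge paths are lifted. Most of the work is to make \<open>vres\<close> computable, by showing that
  its classes look like the edges of \<open>K(q,q)\<close> seen from a unique lowest chamber. The
  axioms \<open>cor_close\<close>, \<open>cor_bipartite\<close> and \<open>cor_connected\<close> are
  what is needed of \<open>K(q,q)\<close> without naming its two classes: a path of three link edges
  closes to a 4-cycle, there are no triangles, and each non-isolated node is joined to an end of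
  every link edge. A swap exchanges the two galleries of length two between chambers that are
  opposite at a vertex. The axiom \<open>no_triangle\<close> is about the polygon, not the link: it
  concerns three sides of one chamber.\<close>

text \<open>\<open>sd c\<close> are the sides of the chamber \<open>c\<close>, and \<open>cor c v e f\<close> says that \<open>e\<close> and \<open>f\<close> are the two
  sides of \<open>c\<close> meeting at its corner \<open>v\<close>.\<close>

locale chamber_system =
  fixes C :: "'c set" and sd :: "'c \<Rightarrow> 'e set"
    and cor :: "'c \<Rightarrow> 'v \<Rightarrow> 'e \<Rightarrow> 'e \<Rightarrow> bool"
  assumes cor_sym: "cor c v e f \<Longrightarrow> cor c v f e"
    and cor_cell: "cor c v e f \<Longrightarrow> c \<in> C \<and> e \<in> sd c"
    and cor_neq: "cor c v e f \<Longrightarrow> e \<noteq> f"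
    and cor_edges: "cor c v e f \<Longrightarrow> cor c v g h \<Longrightarrow> g = e \<or> g = f"
    and cor_unique: "cor c v e f \<Longrightarrow> cor c' v' e f \<Longrightarrow> c = c' \<and> v = v'"
    and cor_side: "cor c v e f \<Longrightarrow> c' \<in> C \<Longrightarrow> e \<in> sd c' \<Longrightarrow> \<exists>g. cor c' v e g"
    and side_unique: "\<lbrakk>c \<in> C; c' \<in> C; c \<noteq> c'; e \<in> sd c; e \<in> sd c'; f \<in> sd c; f \<in> sd c'\<rbrakk> \<Longrightarrow> e = f"
    and cor_close: "cor c v a b \<Longrightarrow> cor d v a b' \<Longrightarrow> cor u v a' b' \<Longrightarrow> \<exists>y. cor y v a' b"
    and cor_bipartite: "cor c v a b \<Longrightarrow> cor d v a b' \<Longrightarrow> \<not> cor x v b b'"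
    and cor_connected: "cor c v a b \<Longrightarrow> cor u v a' b' \<Longrightarrow> (\<exists>x. cor x v a b') \<or> (\<exists>x. cor x v a a')"
    and no_triangle: "cor c v e f \<Longrightarrow> cor c v' f g \<Longrightarrow> cor c v'' e g \<Longrightarrow> False"
begin

lemma cor_other: "cor c v e f \<Longrightarrow> cor c v e g \<Longrightarrow> f = g"
  using cor_edges cor_neq cor_sym by metis

definition pan :: "'e \<Rightarrow> 'c \<Rightarrow> 'c \<Rightarrow> bool" where
  "pan e c c' \<longleftrightarrow> c \<in> C \<and> c' \<in> C \<and> c \<noteq> c' \<and> e \<in> sd c \<and> e \<in> sd c'"

lemma pan_sym: "pan e c c' \<Longrightarrow> pan e c' c"
  by (auto simp: pan_def)

lemma pan_unique: "pan e c c' \<Longrightarrow> pan f c c' \<Longrightarrow> e = f"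
  unfolding pan_def using side_unique by blast

lemma pan_cor: assumes "cor c v a b" "cor x v a b'" "b \<noteq> b'" shows "pan a c x"
  using assms cor_cell cor_other unfolding pan_def by metis

lemma pan_corE:
  assumes "cor c v a b" "pan a c x" obtains b' where "cor x v a b'" "b' \<noteq> b"
  using assms cor_side cor_unique unfolding pan_def by metis

text \<open>Chambers at \<open>v\<close> are pairs of nodes of the two classes of the link; the four chambers are
  \<open>(a, b)\<close>, \<open>(a, b')\<close>, \<open>(a', b')\<close>, \<open>(a', b)\<close>.\<close>

definition square :: "'v \<Rightarrow> 'e \<Rightarrow> 'e \<Rightarrow> 'e \<Rightarrow> 'e \<Rightarrow> 'c \<Rightarrow> 'c \<Rightarrow> 'c \<Rightarrow> 'c \<Rightarrow> bool" where
  "square v a b a' b' c x u y \<longleftrightarrow>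
     a \<noteq> a' \<and> b \<noteq> b' \<and> cor c v a b \<and> cor x v a b' \<and> cor u v a' b' \<and> cor y v a' b"

lemma square_flip: "square v a b a' b' c x u y \<Longrightarrow> square v b a b' a' c y u x"
  by (auto simp: square_def intro: cor_sym)

lemma square_pan:
  assumes "square v a b a' b' c x u y"
  shows "pan a c x" "pan b' x u" "pan a' u y" "pan b c y"
proof -
  show "pan a c x" using assms pan_cor unfolding square_def by blast
  show "pan b' x u" using assms pan_cor cor_sym unfolding square_def by blast
  show "pan a' u y" using assms pan_cor unfolding square_def by blast
  show "pan b c y" using assms pan_cor cor_sym unfolding square_def by blast
qed

text \<open>The sides that \<open>y\<close> shares with \<open>c\<close> and with \<open>u\<close>
  determine its corner, hence the vertex. The sides \<open>a\<close> and \<open>b'\<close> are then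
  the second sides of \<open>c\<close> and \<open>u\<close> there, and these two determine the
  fourth chamber.\<close>

lemma square_fourth_unique:
  assumes "square v a b a' b' c x u y" "square v2 a2 b2 a2' b2' c z u y"
  shows "x = z"
proof -
  have "b = b2" using square_pan(4)[OF assms(1)] square_pan(4)[OF assms(2)] pan_unique by blast
  moreover have "a' = a2'" using square_pan(3)[OF assms(1)] square_pan(3)[OF assms(2)] pan_unique by blast
  ultimately have v: "v = v2" using assms cor_unique unfolding square_def by blast
  have "a = a2" using assms v \<open>b = b2\<close> cor_other cor_sym unfolding square_def by metis
  moreover have "b' = b2'" using assms v \<open>a' = a2'\<close> cor_other unfolding square_def by metis
  ultimately show ?thesis using assms cor_unique unfolding square_def by blast
qed

text \<open>Galleries are listed backwards: the head is the last chamber.\<close>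

inductive sweq :: "'c list \<Rightarrow> 'c list \<Rightarrow> bool" (infix "\<doteq>" 50) where
  refl: "r \<doteq> r"
| swap: "square v a b a' b' c x u y \<Longrightarrow> c # x # u # r \<doteq> c # y # u # r"
| cons: "r \<doteq> s \<Longrightarrow> c # r \<doteq> c # s"
| trans: "r \<doteq> s \<Longrightarrow> s \<doteq> t \<Longrightarrow> r \<doteq> t"

declare sweq.trans [trans]

lemma sweq_sym: "r \<doteq> s \<Longrightarrow> s \<doteq> r"
proof (induction rule: sweq.induct)
  case (swap v a b a' b' c x u y r)
  then show ?case by (rule sweq.swap[OF square_flip])
qed (auto intro: sweq.refl sweq.cons sweq.trans)

lemma sweq_length: "r \<doteq> s \<Longrightarrow> length r = length s"
  by (induction rule: sweq.induct) auto

lemma sweq_hd: "r \<doteq> s \<Longrightarrow> hd r = hd s"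
  by (induction rule: sweq.induct) auto

lemma sweq_Nil: "r \<doteq> s \<Longrightarrow> r = [] \<longleftrightarrow> s = []"
  using sweq_length by fastforce

text \<open>Swaps deep in the gallery are absorbed into the equivalences, so that only one swap
  involving the last chamber is left explicit. The content of Levi's lemma is that several such
  swaps in a row reduce to at most one.\<close>

definition levi :: "'c \<Rightarrow> 'c list \<Rightarrow> 'c list \<Rightarrow> bool" where
  "levi c r s \<longleftrightarrow> r \<doteq> s \<or>
     (\<exists>v a b a' b' x u y t. square v a b a' b' c x u y \<and> r \<doteq> x # u # t \<and> s \<doteq> y # u # t)"

text \<open>The analogue of Levi's lemma for traces. Three pairwise adjacent sides of a chamber do not exist,
  so the case of three commuting last steps does not arise.\<close>

lemma levi: "c # r \<doteq> c # s \<Longrightarrow> levi c r s"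
proof (induction "length r" arbitrary: c r s rule: less_induct)
  case less
  \<comment> \<open>Transitivity is the crux: two squares at \<open>c\<close> with the common
    gallery \<open>m\<close> have to merge. Both describe the tail behind the same chamber
    \<open>y\<close>, and the induction hypothesis compares these shorter tails.\<close>
  have tr: "levi c r s" if rm: "levi c r m" and ms: "levi c m s"
    and IH: "\<And>y m m'. length m < length r \<Longrightarrow> y # m \<doteq> y # m' \<Longrightarrow> levi y m m'" for c r m s
    using rm unfolding levi_def
  proof (elim disjE exE conjE)
    assume "r \<doteq> m"
    with ms show "r \<doteq> s \<or>
      (\<exists>v a b a' b' x u y t. square v a b a' b' c x u y \<and> r \<doteq> x # u # t \<and> s \<doteq> y # u # t)"
      unfolding levi_def by (meson sweq.trans)
  next
    fix v a b a' b' x u y t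
    assume sq: "square v a b a' b' c x u y" and r: "r \<doteq> x # u # t" and m: "m \<doteq> y # u # t"
    show "r \<doteq> s \<or>
      (\<exists>v a b a' b' x u y t. square v a b a' b' c x u y \<and> r \<doteq> x # u # t \<and> s \<doteq> y # u # t)"
      using ms unfolding levi_def
    proof (elim disjE exE conjE)
      assume "m \<doteq> s"
      then show ?thesis using sq r m by (meson sweq.trans sweq_sym)
    next
      fix v2 a2 b2 a2' b2' y2 u2 z t2
      assume sq2: "square v2 a2 b2 a2' b2' c y2 u2 z" and m2: "m \<doteq> y2 # u2 # t2"
        and s: "s \<doteq> z # u2 # t2"
      have yu: "y # u # t \<doteq> y2 # u2 # t2" using m m2 by (meson sweq.trans sweq_sym)
      then have y2: "y2 = y" using sweq_hd by fastforce
      have len: "length (u # t) < length r" using sweq_length[OF r] by simp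
      from IH[OF len yu[unfolded y2]] show ?thesis unfolding levi_def[of y]
      proof (elim disjE exE conjE)
        assume ut: "u # t \<doteq> u2 # t2"
        then have "u2 = u" using sweq_hd by fastforce
        then have "x = z" using square_fourth_unique[OF sq square_flip] sq2 y2 by blast
        then have "r \<doteq> s" using r s ut by (meson sweq.trans sweq_sym sweq.cons)
        then show ?thesis by blast
      next
        fix v3 a3 b3 a3' b3' w h w2 t3
        assume sq3: "square v3 a3 b3 a3' b3' y w h w2" and w: "u # t \<doteq> w # h # t3"
          and w2: "u2 # t2 \<doteq> w2 # h # t3"
        have wu: "w = u" "w2 = u2" using sweq_hd[OF w] sweq_hd[OF w2] by auto
        \<comment> \<open>The sides \<open>b\<close>, \<open>a'\<close> and \<open>b2'\<close> lead
          from \<open>y\<close> to \<open>c\<close>, \<open>u\<close> and \<open>u2\<close>. The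
          three squares make them pairwise adjacent, which is impossible in one chamber.\<close>
        have 1: "cor y v b a'" using sq unfolding square_def using cor_sym by blast
        have 2: "cor y v2 a2 b2'" using sq2 y2 unfolding square_def by blast
        have 3: "cor y v3 a3 b3" using sq3 unfolding square_def by blast
        have "a2 = b" using square_pan(1)[OF sq2] square_pan(4)[OF sq] y2 pan_unique by blast
        moreover have "a3 = a'" using square_pan(1)[OF sq3] square_pan(3)[OF sq] pan_sym wu pan_unique by blast
        moreover have "b3 = b2'" using square_pan(4)[OF sq3] square_pan(2)[OF sq2] y2 pan_sym wu pan_unique by blast
        ultimately show ?thesis using no_triangle 1 2 3 by blast
      qed
    qed
  qed
  \<comment> \<open>Stated for arbitrary lists of the given length, so that rule induction reaches
    the middle term of a transitivity step while the outer hypothesis still applies.\<close>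
  have "levi (hd p) (tl p) (tl p')" if "p \<doteq> p'" "length p = Suc (length r)" for p p'
    using that
  proof (induction rule: sweq.induct)
    case (swap v a b a' b' c x u y r)
    then show ?case unfolding levi_def by simp (meson sweq.refl)
  next
    case (trans p m p')
    from trans.hyps have *: "hd p = hd m" "length p = length m" using sweq_hd sweq_length by auto
    have "length (tl p) = length r" using trans.prems by simp
    then show ?case
      using tr[of "hd p" "tl p" "tl m" "tl p'"] trans.IH trans.prems * less.hyps by auto
  qed (auto simp: levi_def intro: sweq.intros)
  from this[OF less.prems] show ?case by simp
qed

text \<open>The analogue of the descent set of a Coxeter group element: the possible last letters of
  its words, here the sides through which a gallery of the class can enter its last chamber.\<close>

definition descent :: "'c list \<Rightarrow> 'e \<Rightarrow> bool" where
  "descent r e \<longleftrightarrow> (\<exists>x s. r \<doteq> hd r # x # s \<and> pan e (hd r) x)"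

lemma descentI: "r \<doteq> c # x # s \<Longrightarrow> pan e c x \<Longrightarrow> descent r e"
  unfolding descent_def using sweq_hd by fastforce

lemma descentE:
  assumes "descent r e" obtains x s where "r \<doteq> hd r # x # s" "pan e (hd r) x"
  using assms unfolding descent_def by blast

lemma descent_sweq: "r \<doteq> s \<Longrightarrow> descent r e \<Longrightarrow> descent s e"
  unfolding descent_def using sweq_hd sweq_sym sweq.trans by metis

lemma descent_cases:
  assumes r: "c # r \<doteq> c # s" and e: "pan e c (hd r)" and f: "pan f c (hd s)"
  obtains (same) "e = f" "r \<doteq> s"
  | (square) v e' f' x u y t where "square v e f e' f' c x u y" "r \<doteq> x # u # t" "s \<doteq> y # u # t"
  using levi[OF r] unfolding levi_def
proof (elim disjE exE conjE)
  assume "r \<doteq> s"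
  then show thesis using same e f pan_unique sweq_hd by metis
next
  fix v a b a' b' x u y t
  assume sq: "square v a b a' b' c x u y" and rs: "r \<doteq> x # u # t" "s \<doteq> y # u # t"
  have "hd r = x" "hd s = y" using sweq_hd rs by fastforce+
  then have "e = a" "f = b" using square_pan[OF sq] e f pan_unique by blast+
  then show thesis using square sq rs by blast
qed

text \<open>Cancellation of a last step: the square alternative of Levi's lemma would enter through
  two different sides, so a common side leaves only equivalent tails.\<close>

lemma descent_unique:
  assumes "c # r \<doteq> c # s" and "pan e c (hd r)" and "pan e c (hd s)"
  shows "r \<doteq> s"
  using assms
proof (cases rule: descent_cases)
  case (square v e' f' x u y t)
  then show ?thesis unfolding square_def using cor_neq by blast
qed

lemma descents_adjacent:
  assumes "descent r e" "descent r f" "e \<noteq> f"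
  shows "\<exists>v. cor (hd r) v e f"
proof -
  obtain x s where x: "r \<doteq> hd r # x # s" "pan e (hd r) x" using assms descentE by blast
  obtain y t where y: "r \<doteq> hd r # y # t" "pan f (hd r) y" using assms descentE by blast
  have xy: "hd r # x # s \<doteq> hd r # y # t" using x y sweq_sym sweq.trans by blast
  show ?thesis
    by (rule descent_cases[OF xy]) (use x(2) y(2) assms(3) in \<open>auto simp: square_def\<close>)
qed

lemma no_three_descents:
  assumes "descent r e" "descent r f" "descent r g" "e \<noteq> f" "f \<noteq> g" shows "e = g"
  using descents_adjacent assms no_triangle by metis

subsection \<open>Reduced galleries\<close>

text \<open>Each step is tested against the whole swap class of what precedes it. Invariance under
  swaps that change the step order is not built in and is the content of
  \<open>red_sweq\<close>.\<close>

inductive red :: "'c \<Rightarrow> 'c list \<Rightarrow> bool" for c0 where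
  start: "c0 \<in> C \<Longrightarrow> red c0 [c0]"
| step: "red c0 r \<Longrightarrow> pan e c (hd r) \<Longrightarrow> \<not> descent r e \<Longrightarrow> red c0 (c # r)"

lemma red_not_Nil: "red c0 r \<Longrightarrow> r \<noteq> []"
  by (erule red.cases) auto

lemma red_hd: "red c0 r \<Longrightarrow> hd r \<in> C"
  by (erule red.cases) (auto simp: pan_def)

lemma red_ConsE:
  assumes "red c0 (c # r)" "r \<noteq> []"
  obtains e where "red c0 r" "pan e c (hd r)" "\<not> descent r e"
  using assms by (auto elim: red.cases)

text \<open>In a swap the crossings \<open>b'\<close>, \<open>a\<close> are replaced by
  \<open>a'\<close>, \<open>b\<close>. A repetition of \<open>a'\<close> or \<open>b\<close> in the
  new gallery is carried around \<open>v\<close> to a repetition of \<open>a\<close> or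
  \<open>b'\<close> in the old one.\<close>

lemma red_sweq: "r \<doteq> s \<Longrightarrow> red c0 r \<Longrightarrow> red c0 s"
proof (induction rule: sweq.induct)
  case (swap v a b a' b' c x u y r)
  note sq = swap.hyps
  note p = square_pan[OF sq]
  have ne: "a \<noteq> a'" "b \<noteq> b'" and cr: "cor u v a' b'" "cor y v a' b" using sq unfolding square_def by auto
  obtain e where e: "red c0 (x # u # r)" "pan e c x" "\<not> descent (x # u # r) e"
    by (rule red_ConsE[OF swap.prems]) auto
  obtain f where f: "red c0 (u # r)" "pan f x u" "\<not> descent (u # r) f"
    by (rule red_ConsE[OF e(1)]) auto
  have ef: "e = a" "f = b'" using pan_unique[OF e(2) p(1)] pan_unique[OF f(2)] p(2) by auto
  \<comment> \<open>An earlier crossing of \<open>a'\<close> can be swapped past the step from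
    \<open>u\<close> to \<open>x\<close>, where it becomes a crossing of \<open>a\<close> just
    before the step across \<open>a\<close> to \<open>c\<close>.\<close>
  have "\<not> descent (u # r) a'"
  proof
    assume "descent (u # r) a'"
    then obtain z s where z: "u # r \<doteq> u # z # s" "pan a' u z" by (elim descentE) simp
    obtain g where g: "cor z v a' g" "g \<noteq> b'" using pan_corE[OF cr(1) z(2)] by blast
    have x: "cor x v a b'" using sq unfolding square_def by blast
    obtain w where w: "cor w v a g"
      using cor_close[OF g(1) cr(1) x] by blast
    have sq2: "square v b' a g a' x u z w"
      using x w g cr(1) ne by (auto simp: square_def intro: cor_sym)
    have "x # u # r \<doteq> x # w # z # s"
      using z(1) sweq.cons sweq.swap[OF sq2] sweq.trans by blast
    moreover have "pan a x w" using square_pan(4)[OF sq2] .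
    ultimately have "descent (x # u # r) a" using descentI by blast
    then show False using e ef by blast
  qed
  then have y: "red c0 (y # u # r)" using f(1) p(3) pan_sym by (intro red.step[of c0 "u # r" a']) auto
  \<comment> \<open>The descents \<open>a'\<close> and \<open>b\<close> of \<open>y\<close> would
    span a square, necessarily at \<open>v\<close>, and its lower step would enter \<open>u\<close>
    through \<open>b'\<close>, the side crossed next in the old gallery.\<close>
  have "\<not> descent (y # u # r) b"
  proof
    assume "descent (y # u # r) b"
    then obtain z s where z: "y # u # r \<doteq> y # z # s" "pan b y z" by (elim descentE) simp
    show False
    proof (rule descent_cases[OF z(1)])
      show "pan a' y (hd (u # r))" using p(3) pan_sym by simp
      show "pan b y (hd (z # s))" using z(2) by simp
    next
      assume "a' = b" then show False using cr(2) cor_neq by blast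
    next
      fix w e' f' x2 u2 y2 t
      assume sq2: "square w a' b e' f' y x2 u2 y2" and ur: "u # r \<doteq> x2 # u2 # t"
      have x2: "x2 = u" using sweq_hd[OF ur] by simp
      have "cor y w a' b" using sq2 unfolding square_def by blast
      then have w: "w = v" using cr(2) cor_unique by blast
      have "cor u v a' f'" using sq2 x2 w unfolding square_def by blast
      then have "f' = b'" using cr(1) cor_other by blast
      then have "pan b' u u2" using square_pan(2)[OF sq2] x2 by simp
      then have "descent (u # r) b'" using ur x2 descentI by blast
      then show False using f(3) ef by simp
    qed
  qed
  then show ?case using y p(4) by (intro red.step[of c0 "y # u # r" b]) auto
next
  case (cons r s c)
  show ?case
  proof (cases "r = []")
    case True
    then have "s = []" using cons.hyps sweq_Nil by blast
    then show ?thesis using cons.prems True by simp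
  next
    case False
    then obtain e where e: "red c0 r" "pan e c (hd r)" "\<not> descent r e"
      using cons.prems by (metis red_ConsE)
    have "\<not> descent s e" using e(3) descent_sweq[OF sweq_sym[OF cons.hyps]] by blast
    then show ?thesis
      using cons.IH[OF e(1)] e(2) sweq_hd[OF cons.hyps] by (intro red.step[of c0 s e]) auto
  qed
qed auto

subsection \<open>Vertex residues\<close>

lemma red_descentE:
  assumes "red c0 r" "descent r e"
  obtains y s where "r \<doteq> hd r # y # s" "pan e (hd r) y" "red c0 (y # s)" "\<not> descent (y # s) e"
proof -
  obtain y s where y: "r \<doteq> hd r # y # s" "pan e (hd r) y" using assms(2) by (elim descentE)
  have "red c0 (hd r # y # s)" using red_sweq[OF y(1) assms(1)] .
  then obtain f where "red c0 (y # s)" "pan f (hd r) y" "\<not> descent (y # s) f"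
    by (rule red_ConsE) auto
  then show thesis using that y pan_unique by metis
qed

text \<open>Across a descent, \<open>x\<close> and the previous chamber \<open>y\<close> lie on the
  same side \<open>e\<close>: either \<open>x = y\<close> and the gallery is shortened, or
  \<open>x\<close> takes the place of the last chamber. Iterated, this turns any gallery into a
  reduced one that is no longer.\<close>

lemma red_neighbour:
  assumes "red c0 r" "pan e x (hd r)"
  shows "\<exists>r'. red c0 r' \<and> hd r' = x \<and> length r' \<le> Suc (length r)"
proof (cases "descent r e")
  case False
  then show ?thesis using red.step[OF assms] by (intro exI[of _ "x # r"]) simp
next
  case True
  then obtain y s where y: "r \<doteq> hd r # y # s" "pan e (hd r) y" "red c0 (y # s)" "\<not> descent (y # s) e"
    using red_descentE[OF assms(1)] by blast
  have len: "length r = Suc (Suc (length s))" using sweq_length[OF y(1)] by simp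
  show ?thesis
  proof (cases "x = y")
    case True
    then show ?thesis using y(3) len by (intro exI[of _ "y # s"]) simp
  next
    case False
    then have "pan e x y" using assms(2) y(2) unfolding pan_def by auto
    then have "red c0 (x # y # s)" using y(3,4) red.step[of c0 "y # s" e x] by simp
    then show ?thesis using len by (intro exI[of _ "x # y # s"]) simp
  qed
qed

text \<open>The swap classes of reduced galleries are the chambers of a covering. Those around a lift of the
  vertex \<open>v\<close> form a residue, described by its shortest member \<open>s\<close>.\<close>

definition residue_base :: "'c \<Rightarrow> 'v \<Rightarrow> 'e \<Rightarrow> 'e \<Rightarrow> 'c list \<Rightarrow> bool" where
  "residue_base c0 v a0 b0 s \<longleftrightarrow>
     red c0 s \<and> cor (hd s) v a0 b0 \<and> \<not> descent s a0 \<and> \<not> descent s b0"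

text \<open>Chambers at \<open>v\<close> as cells of a \<open>q\<close> by \<open>q\<close> grid
  with \<open>s\<close> at \<open>(a0, b0)\<close>: the base, its line with the same
  \<open>b0\<close>, its line with the same \<open>a0\<close>, and the rest at distance two. The
  rest is reached via \<open>(a, b0)\<close> only; the route via \<open>(a0, b)\<close> is a swap of
  it, so the asymmetry is harmless (\<open>residue_sym\<close>).\<close>

definition residue :: "'v \<Rightarrow> 'e \<Rightarrow> 'e \<Rightarrow> 'c list \<Rightarrow> 'c list \<Rightarrow> bool" where
  "residue v a0 b0 s r \<longleftrightarrow>
     r \<doteq> s \<or>
     (\<exists>c a. a \<noteq> a0 \<and> cor c v a b0 \<and> r \<doteq> c # s) \<or>
     (\<exists>c b. b \<noteq> b0 \<and> cor c v a0 b \<and> r \<doteq> c # s) \<or>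
     (\<exists>c d a b. a \<noteq> a0 \<and> b \<noteq> b0 \<and> cor c v a b \<and> cor d v a b0 \<and> r \<doteq> c # d # s)"

lemma residue_base_sym: "residue_base c0 v a b s \<Longrightarrow> residue_base c0 v b a s"
  by (auto simp: residue_base_def intro: cor_sym)

lemma residue_cases [consumes 1, case_names base left right far]:
  assumes "residue v a0 b0 s r"
  obtains "r \<doteq> s"
    | c a where "a \<noteq> a0" "cor c v a b0" "r \<doteq> c # s"
    | c b where "b \<noteq> b0" "cor c v a0 b" "r \<doteq> c # s"
    | c d a b where "a \<noteq> a0" "b \<noteq> b0" "cor c v a b" "cor d v a b0" "r \<doteq> c # d # s"
  using assms unfolding residue_def by blast

lemma residueI:
  "r \<doteq> s \<Longrightarrow> residue v a0 b0 s r"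
  "a \<noteq> a0 \<Longrightarrow> cor c v a b0 \<Longrightarrow> r \<doteq> c # s \<Longrightarrow> residue v a0 b0 s r"
  "b \<noteq> b0 \<Longrightarrow> cor c v a0 b \<Longrightarrow> r \<doteq> c # s \<Longrightarrow> residue v a0 b0 s r"
  "a \<noteq> a0 \<Longrightarrow> b \<noteq> b0 \<Longrightarrow> cor c v a b \<Longrightarrow> cor d v a b0 \<Longrightarrow> r \<doteq> c # d # s \<Longrightarrow>
     residue v a0 b0 s r"
  unfolding residue_def by blast+

lemma residue_sweq: "residue v a0 b0 s r \<Longrightarrow> r \<doteq> r' \<Longrightarrow> residue v a0 b0 s r'"
  unfolding residue_def by (meson sweq_sym sweq.trans)

lemma residue_far_swap:
  assumes b: "residue_base c0 v a0 b0 s"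
    and c: "a \<noteq> a0" "b \<noteq> b0" "cor c v a b" and d: "cor d v a b0" and d': "cor d' v a0 b"
  shows "c # d # s \<doteq> c # d' # s"
proof -
  have s: "cor (hd s) v a0 b0" "s \<noteq> []" using b red_not_Nil unfolding residue_base_def by auto
  then have "square v a b a0 b0 c d (hd s) d'" using c d d' unfolding square_def by auto
  from sweq.swap[OF this, of "tl s"] s(2) show ?thesis by simp
qed

lemma residue_sym:
  assumes b: "residue_base c0 v a0 b0 s" and r: "residue v a0 b0 s r"
  shows "residue v b0 a0 s r"
  using r
proof (cases rule: residue_cases)
  case (far c d a b)
  have s: "cor (hd s) v a0 b0" using b unfolding residue_base_def by auto
  obtain d' where d': "cor d' v a0 b" using cor_close far s by blast
  have "r \<doteq> c # d' # s" using residue_far_swap[OF b far(1-4) d'] far(5) sweq.trans by blast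
  then show ?thesis using residueI(4)[OF far(2,1) cor_sym[OF far(3)] cor_sym[OF d']] by blast
next
  case base
  then show ?thesis by (rule residueI)
next
  case (left c a)
  then show ?thesis using residueI(3)[OF left(1) cor_sym] by blast
next
  case (right c b)
  then show ?thesis using residueI(2)[OF right(1) cor_sym] by blast
qed

text \<open>If \<open>a\<close> were a descent beside \<open>b0\<close>, Levi's lemma would give a
  square at \<open>v\<close> whose lower step enters \<open>hd s\<close> through \<open>a0\<close>,
  which the base excludes.\<close>

lemma residue_near_red:
  assumes b: "residue_base c0 v a0 b0 s" and c: "a \<noteq> a0" "cor c v a b0"
  shows "red c0 (c # s)" "descent (c # s) b0" "\<not> descent (c # s) a"
proof -
  have s: "red c0 s" "cor (hd s) v a0 b0" "\<not> descent s a0" "\<not> descent s b0" "s \<noteq> []"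
    using b red_not_Nil unfolding residue_base_def by auto
  have p: "pan b0 c (hd s)" using c s(2) pan_cor cor_sym by metis
  show "red c0 (c # s)" by (rule red.step[OF s(1) p s(4)])
  have "c # s \<doteq> c # hd s # tl s" using s(5) by (simp add: sweq.refl)
  then show "descent (c # s) b0" using p descentI by blast
  show "\<not> descent (c # s) a"
  proof
    assume "descent (c # s) a"
    then obtain x t where x: "c # s \<doteq> c # x # t" "pan a c x" by (elim descentE) simp
    show False
    proof (rule descent_cases[OF x(1)])
      show "pan b0 c (hd s)" by (rule p)
    next
      show "pan a c (hd (x # t))" using x by simp
    next
      assume "b0 = a" then show False using c cor_neq by blast
    next
      fix w e' f' x2 u y t'
      assume sq: "square w b0 a e' f' c x2 u y" and st: "s \<doteq> x2 # u # t'"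
      have x2: "x2 = hd s" using sweq_hd[OF st] by simp
      have "cor c w b0 a" using sq unfolding square_def by blast
      then have w: "w = v" using c(2) cor_unique cor_sym by blast
      have "cor (hd s) v b0 f'" using sq x2 w unfolding square_def by blast
      then have "f' = a0" using s(2) cor_other cor_sym by blast
      then have "pan a0 x2 u" using square_pan(2)[OF sq] by simp
      then have "descent s a0" using st descentI by blast
      then show False using s(3) by simp
    qed
  qed
qed

text \<open>The two routes from \<open>s\<close> enter through \<open>a\<close> and through
  \<open>b\<close>. Both sides at \<open>v\<close> being descents, no upward step around
  \<open>v\<close> remains.\<close>

lemma residue_far_red:
  assumes b: "residue_base c0 v a0 b0 s"
    and c: "a \<noteq> a0" "b \<noteq> b0" "cor c v a b" and d: "cor d v a b0"
  shows "red c0 (c # d # s)" "descent (c # d # s) a" "descent (c # d # s) b"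
proof -
  have s: "cor (hd s) v a0 b0" "s \<noteq> []" using b red_not_Nil unfolding residue_base_def by auto
  obtain d' where d': "cor d' v a0 b" using cor_close[OF c(3) d s(1)] by blast
  note n = residue_near_red[OF b c(1) d]
  have p: "pan a c d" using c(2,3) d pan_cor by metis
  show "red c0 (c # d # s)" by (rule red.step[OF n(1) _ n(3)]) (use p in simp)
  show "descent (c # d # s) a" using p descentI sweq.refl by blast
  have "pan b c d'" using c(1,3) d' pan_cor cor_sym by metis
  then show "descent (c # d # s) b"
    using descentI residue_far_swap[OF b c d d'] by blast
qed

lemma residue_red:
  assumes b: "residue_base c0 v a0 b0 s" and r: "residue v a0 b0 s r"
  shows "red c0 r"
  using r
proof (cases rule: residue_cases)
  case base
  then show ?thesis using b red_sweq sweq_sym unfolding residue_base_def by blast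
next
  case (left c a)
  then show ?thesis using residue_near_red(1)[OF b] red_sweq sweq_sym by blast
next
  case (right c b')
  then show ?thesis
    using residue_near_red(1)[OF residue_base_sym[OF b] _ cor_sym] red_sweq sweq_sym by blast
next
  case (far c d a b')
  then show ?thesis using residue_far_red(1)[OF b] red_sweq sweq_sym by blast
qed

lemma residue_corner:
  assumes b: "residue_base c0 v a0 b0 s" and r: "residue v a0 b0 s r"
  shows "\<exists>a b. cor (hd r) v a b"
  using r
proof (cases rule: residue_cases)
  case base
  then show ?thesis using b sweq_hd unfolding residue_base_def by metis
qed (use sweq_hd in fastforce)+

text \<open>The position of the end chamber in the grid around \<open>s\<close> determines a normal
  form of the class. It has to be checked that the position can be read off the chamber.\<close>

lemma residue_unique:
  assumes b: "residue_base c0 v a0 b0 s" and r: "residue v a0 b0 s r" and r': "residue v a0 b0 s r'"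
    and hd: "hd r = hd r'"
  shows "r \<doteq> r'"
proof -
  have s: "cor (hd s) v a0 b0" using b unfolding residue_base_def by auto
  have bip: "\<not> cor x v a b" if "cor c v a b0" "cor c' v b b0" for a b c c' x
    using cor_bipartite cor_sym that by metis
  \<comment> \<open>The two sides at \<open>v\<close> come unordered; the first coordinate is
    recognised as the one joined to \<open>b0\<close> in the link.\<close>
  have canon: "\<exists>l. r \<doteq> l \<and> (\<exists>a b. cor (hd r) v a b \<and>
      (\<exists>x. cor x v a b0) \<and> (\<exists>x. cor x v a0 b) \<and>
      (a = a0 \<and> b = b0 \<and> l = s \<or> a = a0 \<and> b \<noteq> b0 \<and> l = hd r # s \<or> a \<noteq> a0 \<and> b = b0 \<and> l = hd r # s
       \<or> a \<noteq> a0 \<and> b \<noteq> b0 \<and> (\<exists>d. cor d v a b0 \<and> l = hd r # d # s)))"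
    if "residue v a0 b0 s r" for r
    using that
  proof (cases rule: residue_cases)
    case base
    then show ?thesis using s sweq_hd by metis
  next
    case (left c a)
    have "hd r = c" using sweq_hd[OF left(3)] by simp
    then show ?thesis using left s by blast
  next
    case (right c b)
    have "hd r = c" using sweq_hd[OF right(3)] by simp
    then show ?thesis using right s by blast
  next
    case (far c d a b)
    have "hd r = c" using sweq_hd[OF far(5)] by simp
    moreover obtain y where "cor y v a0 b" using far s cor_close by blast
    ultimately show ?thesis using far by blast
  qed
  obtain l a b x y where l: "r \<doteq> l" "cor (hd r) v a b" "cor x v a b0" "cor y v a0 b"
     and l2: "a = a0 \<and> b = b0 \<and> l = s \<or> a = a0 \<and> b \<noteq> b0 \<and> l = hd r # s \<or> a \<noteq> a0 \<and> b = b0 \<and> l = hd r # s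
       \<or> a \<noteq> a0 \<and> b \<noteq> b0 \<and> (\<exists>d. cor d v a b0 \<and> l = hd r # d # s)"
    using canon[OF r] by blast
  obtain l' a' b' x' y' where l': "r' \<doteq> l'" "cor (hd r') v a' b'" "cor x' v a' b0" "cor y' v a0 b'"
     and l2': "a' = a0 \<and> b' = b0 \<and> l' = s \<or> a' = a0 \<and> b' \<noteq> b0 \<and> l' = hd r' # s \<or> a' \<noteq> a0 \<and> b' = b0 \<and> l' = hd r' # s
       \<or> a' \<noteq> a0 \<and> b' \<noteq> b0 \<and> (\<exists>d. cor d v a' b0 \<and> l' = hd r' # d # s)"
    using canon[OF r'] by blast
  have "a' = a \<or> a' = b" using cor_edges l(2) l'(2) hd by metis
  \<comment> \<open>Two nodes joined to \<open>b0\<close> lie in the same class of the link, so they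
    are not the two sides of one chamber.\<close>
  moreover have "a' \<noteq> b" using bip[OF l(3) l'(3)] l(2) by metis
  ultimately have aa: "a' = a" by simp
  then have bb: "b' = b" using l(2) l'(2) hd cor_other by metis
  have "l = l'" using l2 l2' aa bb hd cor_unique by metis
  then show ?thesis using l l' sweq_sym sweq.trans by blast
qed

lemma residue_ex:
  assumes b: "residue_base c0 v a0 b0 s" and c: "cor c v a b"
  shows "\<exists>r. residue v a0 b0 s r \<and> hd r = c"
proof -
  have s: "cor (hd s) v a0 b0" using b unfolding residue_base_def by auto
  have *: "\<exists>r. residue v a0 b0 s r \<and> hd r = c" if c: "cor c v a b" and x: "cor x v a b0" for a b x
  proof -
    consider "a = a0" "b = b0" | "a = a0" "b \<noteq> b0" | "a \<noteq> a0" "b = b0" | "a \<noteq> a0" "b \<noteq> b0" by blast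
    then show ?thesis
    proof cases
      case 1
      then have "c = hd s" using c s cor_unique by blast
      then show ?thesis using residueI(1) sweq.refl by blast
    next
      case 2
      then have "residue v a0 b0 s (c # s)" using c residueI(3) sweq.refl by blast
      then show ?thesis by (intro exI[of _ "c # s"]) simp
    next
      case 3
      then have "residue v a0 b0 s (c # s)" using c residueI(2) sweq.refl by blast
      then show ?thesis by (intro exI[of _ "c # s"]) simp
    next
      case 4
      then have "residue v a0 b0 s (c # x # s)" using c x residueI(4) sweq.refl by blast
      then show ?thesis by (intro exI[of _ "c # x # s"]) simp
    qed
  qed
  show ?thesis
    using cor_connected[OF c s]
  proof (elim disjE exE)
    fix x assume "cor x v a b0" then show ?thesis using * c by blast
  next
    fix x assume "cor x v a a0"
    then obtain y where "cor y v b b0" using cor_close[OF s cor_sym cor_sym[OF c]] by blast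
    then show ?thesis using * cor_sym[OF c] by blast
  qed
qed

text \<open>Removing last steps that cross sides at \<open>v\<close> ends after at most two. A third
  would cross \<open>a0\<close>; swapped past the second it would become a crossing of
  \<open>a\<close>, although the gallery \<open>y # s\<close> has no descent
  \<open>a\<close>.\<close>

lemma residue_base_ex_aux:
  assumes r: "red c0 r" and c: "cor (hd r) v a b" and da: "descent r a"
  shows "\<exists>a0 b0 s. residue_base c0 v a0 b0 s \<and> residue v a0 b0 s r"
proof -
  obtain y s where y: "r \<doteq> hd r # y # s" "pan a (hd r) y" "red c0 (y # s)" "\<not> descent (y # s) a"
    using red_descentE[OF r da] by blast
  obtain b0 where b0: "cor y v a b0" "b0 \<noteq> b" using pan_corE[OF c y(2)] by blast
  show ?thesis
  proof (cases "descent (y # s) b0")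
    case False
    then have "residue_base c0 v a b0 (y # s)" using y b0 unfolding residue_base_def by simp
    moreover have "residue v a b0 (y # s) r" using residueI(3)[OF _ c y(1)] b0 by simp
    ultimately show ?thesis by blast
  next
    case True
    then obtain z t where z: "y # s \<doteq> y # z # t" "pan b0 y z" "red c0 (z # t)" "\<not> descent (z # t) b0"
      using red_descentE[OF y(3)] by (metis list.sel(1))
    obtain a0 where a0: "cor z v b0 a0" "a0 \<noteq> a" using pan_corE[OF cor_sym[OF b0(1)] z(2)] by blast
    have "\<not> descent (z # t) a0"
    proof
      assume "descent (z # t) a0"
      then obtain w t' where w: "z # t \<doteq> z # w # t'" "pan a0 z w" by (elim descentE) simp
      obtain b1 where b1: "cor w v a0 b1" "b1 \<noteq> b0" using pan_corE[OF cor_sym[OF a0(1)] w(2)] by blast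
      obtain u where u: "cor u v a b1" using cor_close[OF b1(1) cor_sym[OF a0(1)] b0(1)] by blast
      have sq: "square v b0 a b1 a0 y z w u"
        using b0 a0 b1 u by (auto simp: square_def intro: cor_sym)
      have "y # z # t \<doteq> y # u # w # t'"
        using sweq.cons[OF w(1)] sweq.swap[OF sq] sweq.trans by blast
      then have "descent (y # s) a"
        using z(1) sweq.trans square_pan(4)[OF sq] descentI by blast
      then show False using y by blast
    qed
    then have "residue_base c0 v a0 b0 (z # t)" using z a0 cor_sym unfolding residue_base_def by auto
    moreover have "r \<doteq> hd r # y # z # t" using y(1) sweq.cons[OF z(1)] sweq.trans by blast
    then have "residue v a0 b0 (z # t) r" using residueI(4)[OF a0(2)[symmetric] b0(2)[symmetric] c b0(1)] by blast
    ultimately show ?thesis by blast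
  qed
qed

lemma residue_base_ex:
  assumes r: "red c0 r" and c: "cor (hd r) v a b"
  obtains a0 b0 s where "residue_base c0 v a0 b0 s" "residue v a0 b0 s r"
proof -
  consider "descent r a" | "descent r b" | "\<not> descent r a" "\<not> descent r b" by blast
  then show thesis
  proof cases
    case 1
    then show thesis using residue_base_ex_aux[OF r c] that by blast
  next
    case 2
    then show thesis using residue_base_ex_aux[OF r cor_sym[OF c]] that by blast
  next
    case 3
    then show thesis using that[of a b r] r c residueI(1) sweq.refl unfolding residue_base_def by blast
  qed
qed

text \<open>\<open>vres c0 v r r'\<close>: the chambers \<open>r\<close> and \<open>r'\<close> of the covering share a lift of \<open>v\<close>.\<close>

inductive vres :: "'c \<Rightarrow> 'v \<Rightarrow> 'c list \<Rightarrow> 'c list \<Rightarrow> bool" for c0 v where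
  eq: "red c0 r \<Longrightarrow> r \<doteq> r' \<Longrightarrow> vres c0 v r r'"
| up: "red c0 r \<Longrightarrow> pan e c (hd r) \<Longrightarrow> cor c v e f \<Longrightarrow> \<not> descent r e \<Longrightarrow> vres c0 v r (c # r)"
| sym: "vres c0 v r r' \<Longrightarrow> vres c0 v r' r"
| trans: "vres c0 v r r' \<Longrightarrow> vres c0 v r' r'' \<Longrightarrow> vres c0 v r r''"

lemma vres_red: "vres c0 v r r' \<Longrightarrow> red c0 r \<and> red c0 r'"
  by (induction rule: vres.induct) (auto intro: red.intros red_sweq)

section \<open>Residues as the classes of \<open>vres\<close>\<close>

lemma residue_near_up:
  assumes b: "residue_base c0 v a0 b0 s" and d: "a \<noteq> a0" "cor d v a b0" "r \<doteq> d # s"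
    and e: "pan e c (hd r)" "cor c v e f" "\<not> descent r e"
  shows "residue v a0 b0 s (c # r)"
proof -
  have hd: "hd r = d" using sweq_hd[OF d(3)] by simp
  have "descent r b0" using residue_near_red(2)[OF b d(1,2)] descent_sweq[OF sweq_sym[OF d(3)]] by blast
  then have "e \<noteq> b0" using e by blast
  obtain g where g: "cor d v e g" "g \<noteq> f" using pan_corE[OF e(2,1)] hd by blast
  then have "e = a" using cor_edges[OF d(2)] \<open>e \<noteq> b0\<close> by blast
  then have "g = b0" using g d cor_other by blast
  then show ?thesis
    using residueI(4)[OF d(1) _ _ d(2) sweq.cons[OF d(3)]] e(2) g(2) \<open>e = a\<close> by metis
qed

lemma residue_up:
  assumes b: "residue_base c0 v a0 b0 s" and r: "residue v a0 b0 s r"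
    and e: "pan e c (hd r)" "cor c v e f" "\<not> descent r e"
  shows "residue v a0 b0 s (c # r)"
  using r
proof (cases rule: residue_cases)
  case base
  have s: "cor (hd r) v a0 b0" using b sweq_hd[OF base] unfolding residue_base_def by simp
  obtain g where g: "cor (hd r) v e g" "g \<noteq> f" using pan_corE[OF e(2,1)] by blast
  then consider "e = a0" "g = b0" | "e = b0" "g = a0" using cor_edges[OF s] s cor_other cor_sym by metis
  then show ?thesis
  proof cases
    case 1
    then show ?thesis using residueI(3)[OF _ _ sweq.cons[OF base]] e g by metis
  next
    case 2
    then show ?thesis using residueI(2)[OF _ cor_sym sweq.cons[OF base]] e g by metis
  qed
next
  case (left d a)
  then show ?thesis using residue_near_up[OF b] e by blast
next
  case (right d b')
  then have "residue v b0 a0 s (c # r)"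
    using residue_near_up[OF residue_base_sym[OF b] _ cor_sym] e by blast
  then show ?thesis using residue_sym[OF residue_base_sym[OF b]] by blast
next
  case (far d d' a b')
  have hd: "hd r = d" using sweq_hd[OF far(5)] by simp
  obtain g where g: "cor d v e g" using pan_corE[OF e(2,1)] hd by blast
  then have "e = a \<or> e = b'" using cor_edges[OF far(3)] by blast
  then have "descent r e"
    using residue_far_red(2,3)[OF b far(1-4)] descent_sweq[OF sweq_sym[OF far(5)]] by blast
  then show ?thesis using e by blast
qed

lemma residue_near_down:
  assumes b: "residue_base c0 v a0 b0 s" and d: "a \<noteq> a0" "cor d v a b0" "c # r \<doteq> d # s"
    and e: "pan e c (hd r)" "cor c v e f" and ne: "r \<noteq> []"
  shows "residue v a0 b0 s r"
proof -
  have cd: "c = d" using sweq_hd[OF d(3)] by simp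
  have "c # r \<doteq> c # hd r # tl r" using ne by (simp add: sweq.refl)
  then have "descent (c # r) e" using e(1) descentI by blast
  then have "descent (d # s) e" using d(3) descent_sweq by blast
  then have "e \<noteq> a" using residue_near_red(3)[OF b d(1,2)] by blast
  then have eb: "e = b0" using cor_edges d(2) e(2) cd by metis
  have s: "cor (hd s) v a0 b0" using b unfolding residue_base_def by simp
  have "pan b0 c (hd s)" using d(1,2) s cd pan_cor cor_sym by metis
  then have "r \<doteq> s" using descent_unique[of c r s e] d(3) e(1) cd eb by blast
  then show ?thesis by (rule residueI)
qed

text \<open>The step removed is a descent at \<open>v\<close>. By \<open>descent_unique\<close> the
  side crossed fixes what remains, and this is one of the members of the residue below; the base has
  no such descent.\<close>

lemma residue_down:
  assumes b: "residue_base c0 v a0 b0 s" and r: "residue v a0 b0 s (c # r)"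
    and e: "pan e c (hd r)" "cor c v e f" and ne: "r \<noteq> []"
  shows "residue v a0 b0 s r"
  using r
proof (cases rule: residue_cases)
  case base
  have "c # r \<doteq> c # hd r # tl r" using ne by (simp add: sweq.refl)
  then have "descent s e" using base e(1) descentI descent_sweq by blast
  moreover have "cor c v a0 b0" using b sweq_hd[OF base] unfolding residue_base_def by simp
  ultimately show ?thesis using b cor_edges e(2) unfolding residue_base_def by metis
next
  case (left d a)
  then show ?thesis using residue_near_down[OF b] e ne by blast
next
  case (right d b')
  then have "residue v b0 a0 s r"
    using residue_near_down[OF residue_base_sym[OF b] _ cor_sym] e ne by blast
  then show ?thesis using residue_sym[OF residue_base_sym[OF b]] by blast
next
  case (far d d' a b')
  have hd: "c = d" using sweq_hd[OF far(5)] by simp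
  have s: "cor (hd s) v a0 b0" using b unfolding residue_base_def by simp
  consider "e = a" | "e = b'" using cor_edges[OF far(3)] e(2) hd by blast
  then show ?thesis
  proof cases
    case 1
    have "pan a c d'" using far hd pan_cor by blast
    then have "r \<doteq> d' # s" using descent_unique[of c r "d' # s" e] far(5) e(1) hd 1 by simp
    then show ?thesis using residueI(2) far by blast
  next
    case 2
    obtain y where y: "cor y v a0 b'" using cor_close[OF far(3,4) s] by blast
    have "c # r \<doteq> c # y # s" using residue_far_swap[OF b far(1-4) y] far(5) hd sweq.trans by blast
    moreover have "pan b' c y" using far(1,3) y hd pan_cor cor_sym by metis
    ultimately have "r \<doteq> y # s" using descent_unique[of c r "y # s" e] e(1) hd 2 by simp
    then show ?thesis using residueI(3) far y by blast
  qed
qed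

text \<open>A generated equivalence relation is controlled by an invariant: membership in a residue
  survives each generating step in both directions.\<close>

lemma vres_residue:
  "vres c0 v r r' \<Longrightarrow> residue_base c0 v a0 b0 s \<Longrightarrow> residue v a0 b0 s r \<longleftrightarrow> residue v a0 b0 s r'"
proof (induction rule: vres.induct)
  case (eq r r')
  then show ?case using residue_sweq sweq_sym by blast
next
  case (up r e c f)
  then show ?case using residue_up residue_down red_not_Nil by blast
qed auto

lemma vres_baseE:
  assumes "vres c0 v r r'" "cor (hd r) v a b"
  obtains a0 b0 s where "residue_base c0 v a0 b0 s" "residue v a0 b0 s r" "residue v a0 b0 s r'"
  using assms residue_base_ex vres_red vres_residue by metis

text \<open>Local injectivity of the covering around a lifted vertex; it concludes the proof of
  \<open>red_unique\<close>.\<close>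

lemma vres_unique:
  assumes "vres c0 v r r'" "cor (hd r) v a b" "hd r = hd r'"
  shows "r \<doteq> r'"
  using vres_baseE[OF assms(1,2)] residue_unique assms(3) by metis

lemma vres_corner:
  assumes "vres c0 v r r'" "cor (hd r) v a b"
  shows "\<exists>a b. cor (hd r') v a b"
  using vres_baseE[OF assms] residue_corner by metis

text \<open>The class on the right is the lowest one of the residue lying on \<open>e\<close>, the
  gate of the panel. All others on \<open>e\<close> are one step above it, across \<open>e\<close>
  itself, and such a step is also a generator of \<open>vres\<close> at any end \<open>w\<close> of
  \<open>e\<close>.\<close>

lemma residue_panel:
  assumes b: "residue_base c0 v a0 b0 s" and x: "cor x v e b0" and y: "cor y w e g"
    and r: "residue v a0 b0 s r" and e: "cor (hd r) v e f"
  shows "vres c0 w r (if e = a0 then s else x # s)"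
proof -
  have s: "cor (hd s) v a0 b0" "red c0 s" "\<not> descent s a0" using b unfolding residue_base_def by auto
  have red: "red c0 r" using residue_red[OF b r] .
  have eb: "e \<noteq> b0" using x cor_neq by blast
  show ?thesis
    using r
  proof (cases rule: residue_cases)
    case base
    then have "e = a0" using cor_edges[OF s(1)] e eb sweq_hd by metis
    then show ?thesis using vres.eq[OF red base] by simp
  next
    case (left c a)
    then have "hd r = c" using sweq_hd by fastforce
    then have "e = a" using cor_edges[OF left(2)] e eb by blast
    moreover have "c = x" using left(2) x \<open>e = a\<close> cor_unique by blast
    ultimately show ?thesis using left vres.eq[OF red] by simp
  next
    case (right c b')
    then have hd: "hd r = c" using sweq_hd by fastforce
    have "e \<noteq> b'" using cor_bipartite[OF s(1) right(2)] x cor_sym by blast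
    then have ea: "e = a0" using cor_edges[OF right(2)] e hd by blast
    have p: "pan a0 c (hd s)" using pan_cor[OF right(2) s(1)] right(1) by blast
    then obtain h where "cor c w a0 h" using cor_side[OF y] ea unfolding pan_def by blast
    then have "vres c0 w s (c # s)" using vres.up[OF s(2) p _ s(3)] by blast
    from vres.trans[OF vres.eq[OF red right(3)] vres.sym[OF this]] show ?thesis using ea by simp
  next
    case (far c d a b')
    then have hd: "hd r = c" using sweq_hd by fastforce
    obtain z where "cor z v a0 b'" using cor_close[OF far(3,4) s(1)] by blast
    then have "e \<noteq> b'" using cor_bipartite[OF s(1)] x cor_sym by blast
    then have ea: "e = a" using cor_edges[OF far(3)] e hd by blast
    then have dx: "d = x" using far(4) x cor_unique by blast
    have p: "pan a c (hd (d # s))" using pan_cor[OF far(3,4)] far(2) by simp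
    then obtain h where "cor c w a h" using cor_side[OF y] ea unfolding pan_def by blast
    then have "vres c0 w (d # s) (c # d # s)"
      using vres.up[OF residue_near_red(1)[OF b far(1,4)] p _ residue_near_red(3)[OF b far(1,4)]] by blast
    from vres.trans[OF vres.eq[OF red far(5)] vres.sym[OF this]] show ?thesis
      using ea dx far(1) by simp
  qed
qed

text \<open>Both classes are tied at \<open>w\<close> to the gate of the panel \<open>e\<close>.
  Hence a lift of an edge at one end determines the lift of the other end, whatever representative
  is used.\<close>

lemma vres_edge:
  assumes v: "vres c0 v r r'" and e: "cor (hd r) v e f" "cor (hd r') v e f'" and y: "cor y w e g"
  shows "vres c0 w r r'"
proof -
  obtain a0 b0 s where b: "residue_base c0 v a0 b0 s" "residue v a0 b0 s r" "residue v a0 b0 s r'"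
    using vres_baseE[OF v e(1)] .
  have s: "cor (hd s) v a0 b0" using b(1) unfolding residue_base_def by simp
  have *: "vres c0 w r r'" if "residue_base c0 v a0 b0 s" "residue v a0 b0 s r" "residue v a0 b0 s r'"
     "cor x v e b0" for a0 b0 x
    by (rule vres.trans[OF residue_panel[OF that(1,4) y that(2) e(1)]
          vres.sym[OF residue_panel[OF that(1,4) y that(3) e(2)]]])
  show ?thesis using cor_connected[OF e(1) s]
    using * b residue_sym residue_base_sym by blast
qed

text \<open>By \<open>residue_panel\<close> with \<open>w = v\<close>, the class \<open>r\<close> is
  tied to the gate of one of its panels, and the gate is the base or one step above it.\<close>

lemma residue_vres:
  assumes b: "residue_base c0 v a0 b0 s" and r: "residue v a0 b0 s r"
  shows "vres c0 v s r"
proof -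
  have s: "cor (hd s) v a0 b0" using b unfolding residue_base_def by simp
  obtain a' b' where r': "cor (hd r) v a' b'" using residue_corner[OF b r] by blast
  have rs: "residue v a0 b0 s s" using residueI(1) sweq.refl by blast
  have *: "vres c0 v s r" if b: "residue_base c0 v a0 b0 s" and r: "residue v a0 b0 s r"
    and c: "cor (hd r) v e f" and x: "cor x v e b0" for a0 b0 e f x
  proof -
    have "cor (hd s) v a0 b0" "red c0 s" "\<not> descent s b0" using b unfolding residue_base_def by auto
    then have "e \<noteq> a0 \<Longrightarrow> vres c0 v s (x # s)"
      using vres.up[of c0 s b0 x v e] pan_cor cor_sym x by metis
    moreover have "vres c0 v s s" using vres.eq sweq.refl \<open>red c0 s\<close> by blast
    ultimately have "vres c0 v s (if e = a0 then s else x # s)" by simp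
    then show ?thesis by (rule vres.trans) (rule vres.sym[OF residue_panel[OF b x x r c]])
  qed
  show ?thesis using cor_connected[OF r' s] 
  proof (elim disjE exE)
    fix x assume "cor x v a' b0"
    then show ?thesis using *[OF b r r'] by blast
  next
    fix x assume "cor x v a' a0"
    then show ?thesis using *[OF residue_base_sym[OF b] residue_sym[OF b r] r'] by blast
  qed
qed

text \<open>Local surjectivity of the covering; it provides the lifts of single edges.\<close>

lemma vres_ex:
  assumes r: "red c0 r" and v: "cor (hd r) v a b" and c: "cor c v a' b'"
  shows "\<exists>r'. vres c0 v r r' \<and> hd r' = c"
proof -
  obtain a0 b0 s where b: "residue_base c0 v a0 b0 s" "residue v a0 b0 s r"
    using residue_base_ex[OF r v] .
  obtain r' where r': "residue v a0 b0 s r'" "hd r' = c" using residue_ex[OF b(1) c] by blast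
  then show ?thesis
    using vres.trans[OF vres.sym[OF residue_vres[OF b]] residue_vres[OF b(1) r'(1)]] by blast
qed

end

section \<open>The Bourdon building as a chamber system\<close>

lemma Suc_mod_if: "i < p \<Longrightarrow> Suc i mod p = (if Suc i = p then 0 else Suc i)"
  by auto

lemma Suc_mod_inj: "i < p \<Longrightarrow> j < p \<Longrightarrow> Suc i mod p = Suc j mod p \<longleftrightarrow> i = j"
  by (auto simp: Suc_mod_if)

lemma Suc_mod_surj:
  assumes "j < p" obtains i where "i < p" "Suc i mod p = j"
proof (cases j)
  case 0
  then show thesis using that[of "p - 1"] assms by auto
next
  case (Suc k)
  then show thesis using that[of k] assms by auto
qed

text \<open>Side \<open>i\<close> runs from corner \<open>i\<close> to corner \<open>i + 1\<close>,
  so sides \<open>i\<close> and \<open>i + 1\<close> meet at the corner numbered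
  \<open>i + 1\<close>. This is one link edge with its chamber made explicit.\<close>

definition cell_corner ::
  "nat \<Rightarrow> ('v, 'e, 'c) polygonal_complex \<Rightarrow> 'c \<Rightarrow> 'v \<Rightarrow> 'e \<Rightarrow> 'e \<Rightarrow> bool" where
  "cell_corner p X c v e f \<longleftrightarrow>
     c \<in> cells X \<and> (\<exists>i<p. corner X c (Suc i mod p) = v \<and>
        {e, f} = {side X c i, side X c (Suc i mod p)})"

lemma link_adj_cell_corner: "link_adj p X v e f \<longleftrightarrow> (\<exists>c. cell_corner p X c v e f)"
  unfolding link_adj_def cell_corner_def by blast

lemma edge_path_end_unique: "edge_path X u ds v \<Longrightarrow> edge_path X u ds w \<Longrightarrow> v = w"
  by (induction X u ds v rule: edge_path.induct) auto

lemma edge_path_append: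
  assumes "edge_path X u (xs @ ys) v" "u \<in> verts X" "\<And>e. e \<in> edges X \<Longrightarrow> ends X e \<subseteq> verts X"
  shows "\<exists>m. edge_path X u xs m \<and> edge_path X m ys v"
  using assms(1,2)
proof (induction xs arbitrary: u)
  case (Cons d xs)
  obtain a e b where d: "d = (a, e, b)" by (cases d)
  then have "b \<in> verts X" using Cons.prems assms(3)[of e] by auto
  then obtain m where "edge_path X b xs m" "edge_path X m ys v" using Cons d by auto
  then show ?case using Cons.prems d by auto
qed auto

lemma equivclp_invariant:
  assumes "equivclp R x y" and "\<And>x y. R x y \<Longrightarrow> P x \<longleftrightarrow> P y"
  shows "P x \<longleftrightarrow> P y"
  using assms(1) by (induction rule: equivclp_induct) (use assms(2) in auto)

locale bourdon =
  fixes p q :: nat and X :: "('v, 'e, 'c) polygonal_complex"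
  assumes p: "p \<ge> 5" and building: "bourdon_building p q X"
begin

lemma polygonal: "polygonal p X"
  and small: "small_intersections p X"
  and links: "v \<in> verts X \<Longrightarrow> is_complete_bipartite q (link_nodes X v) (link_adj p X v)"
  and sc: "simply_connected_complex p X"
  using building unfolding bourdon_building_def by blast+

lemma corner_vert: "c \<in> cells X \<Longrightarrow> i < p \<Longrightarrow> corner X c i \<in> verts X"
  using polygonal unfolding polygonal_def corners_def by blast

lemma side_edge: "c \<in> cells X \<Longrightarrow> i < p \<Longrightarrow> side X c i \<in> edges X"
  using polygonal unfolding polygonal_def sides_def by blast

lemma ends_side:
  "c \<in> cells X \<Longrightarrow> i < p \<Longrightarrow> ends X (side X c i) = {corner X c i, corner X c (Suc i mod p)}"
  using polygonal unfolding polygonal_def by blast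

lemma corner_inj:
  "c \<in> cells X \<Longrightarrow> i < p \<Longrightarrow> j < p \<Longrightarrow> corner X c i = corner X c j \<longleftrightarrow> i = j"
  using polygonal unfolding polygonal_def inj_on_def by blast

lemma side_inj:
  assumes "c \<in> cells X" "i < p" "j < p"
  shows "side X c i = side X c j \<longleftrightarrow> i = j"
proof
  assume "side X c i = side X c j"
  then have "{corner X c i, corner X c (Suc i mod p)} = {corner X c j, corner X c (Suc j mod p)}"
    using ends_side[OF assms(1,2)] ends_side[OF assms(1,3)] by simp
  then have "i = j \<or> i = Suc j mod p \<and> Suc i mod p = j"
    using assms corner_inj p by (auto simp: doubleton_eq_iff)
  then show "i = j" using assms p by (auto simp: Suc_mod_if split: if_splits)
qed simp

lemma side_unique:
  assumes "c \<in> cells X" "c' \<in> cells X" "c \<noteq> c'"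
    and "e \<in> sides p X c" "e \<in> sides p X c'" "f \<in> sides p X c" "f \<in> sides p X c'"
  shows "e = f"
proof -
  have "sides p X c \<inter> sides p X c' \<noteq> {}" using assms by blast
  then obtain g where "sides p X c \<inter> sides p X c' = {g}"
    using small assms(1-3) unfolding small_intersections_def by metis
  then show ?thesis using assms by (metis IntI singletonD)
qed

lemma cell_corner_sym: "cell_corner p X c v e f \<Longrightarrow> cell_corner p X c v f e"
  unfolding cell_corner_def by (simp add: insert_commute)

lemma cell_cornerE:
  assumes "cell_corner p X c v e f"
  obtains i where "c \<in> cells X" "i < p" "v = corner X c (Suc i mod p)"
    "e = side X c i \<and> f = side X c (Suc i mod p) \<or> f = side X c i \<and> e = side X c (Suc i mod p)"
  using assms unfolding cell_corner_def doubleton_eq_iff by blast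

lemma cell_corner_cell: "cell_corner p X c v e f \<Longrightarrow> c \<in> cells X \<and> e \<in> sides p X c"
  using p by (elim cell_cornerE) (auto simp: sides_def)

lemma cell_corner_incident:
  assumes "cell_corner p X c v e f" shows "v \<in> verts X" "e \<in> edges X" "v \<in> ends X e"
  using assms p by (auto elim!: cell_cornerE simp: corner_vert side_edge ends_side)

lemma cell_corner_neq: "cell_corner p X c v e f \<Longrightarrow> e \<noteq> f"
  using p by (elim cell_cornerE) (auto simp: side_inj Suc_mod_if split: if_splits)

lemma cell_corner_edges:
  assumes "cell_corner p X c v e f" "cell_corner p X c v g h"
  shows "g = e \<or> g = f"
  using assms p by (elim cell_cornerE) (auto simp: corner_inj Suc_mod_inj)

lemma cell_corner_ex:
  assumes "c \<in> cells X" "e \<in> sides p X c" "v \<in> ends X e"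
  shows "\<exists>g. cell_corner p X c v e g"
proof -
  obtain j where j: "j < p" "e = side X c j" using assms unfolding sides_def by blast
  then consider "v = corner X c j" | "v = corner X c (Suc j mod p)"
    using assms ends_side by blast
  then show ?thesis
  proof cases
    case 1
    obtain i where "i < p" "Suc i mod p = j" using Suc_mod_surj j(1) .
    then show ?thesis using 1 j assms unfolding cell_corner_def by blast
  next
    case 2
    then show ?thesis using j assms unfolding cell_corner_def by blast
  qed
qed

text \<open>Two distinct sides lie together in only one chamber by small intersections, and in a
  polygon with more than two sides a pair of consecutive sides is consecutive in one way
  only.\<close>

lemma cell_corner_unique:
  assumes c: "cell_corner p X c v e f" and c': "cell_corner p X c' v' e f"
  shows "c = c' \<and> v = v'"
proof -
  have *: "c = c'"
    using side_unique cell_corner_cell cell_corner_neq cell_corner_sym c c' by metis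
  obtain i where i: "c \<in> cells X" "i < p" "v = corner X c (Suc i mod p)"
    "e = side X c i \<and> f = side X c (Suc i mod p) \<or> f = side X c i \<and> e = side X c (Suc i mod p)"
    using c by (rule cell_cornerE)
  obtain j where j: "j < p" "v' = corner X c' (Suc j mod p)"
    "e = side X c' j \<and> f = side X c' (Suc j mod p) \<or> f = side X c' j \<and> e = side X c' (Suc j mod p)"
    using c' by (rule cell_cornerE)
  have "i = j \<or> i = Suc j mod p \<and> Suc i mod p = j"
    using i j * p by (auto simp: side_inj)
  then have "i = j" using i j p by (auto simp: Suc_mod_if split: if_splits)
  then show ?thesis using * i j by simp
qed

lemma cell_corner_no_triangle:
  assumes "cell_corner p X c v e f" "cell_corner p X c v' f g" "cell_corner p X c v'' e g"
  shows False
proof -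
  \<comment> \<open>Going round the triple adds three terms 1 or -1. The sum is odd, of absolute
    value at most 3, and would have to be divisible by \<open>p\<close>.\<close>
  have *: "(\<And>x y z. x < p \<Longrightarrow> y < p \<Longrightarrow> z < p \<Longrightarrow>
     y = Suc x mod p \<or> x = Suc y mod p \<Longrightarrow> z = Suc y mod p \<or> y = Suc z mod p \<Longrightarrow>
     z = Suc x mod p \<or> x = Suc z mod p \<Longrightarrow> False)"
    using p by (auto simp: Suc_mod_if split: if_splits)
  have c: "c \<in> cells X" using assms cell_corner_cell by blast
  have adj: "y = Suc x mod p \<or> x = Suc y mod p"
    if "cell_corner p X c v (side X c x) (side X c y)" "x < p" "y < p" for x y v
    using that(1) by (rule cell_cornerE) (use that p side_inj[OF c] in auto)
  have "e \<in> sides p X c" "f \<in> sides p X c" "g \<in> sides p X c"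
    using assms cell_corner_cell cell_corner_sym by blast+
  then obtain x y z where xyz: "x < p" "y < p" "z < p" "e = side X c x" "f = side X c y" "g = side X c z"
    unfolding sides_def by blast
  show False
    by (rule *[OF xyz(1-3)]) (use adj assms xyz in blast)+
qed

lemma link_bipartition:
  assumes "v \<in> verts X"
  obtains A B where "A \<inter> B = {}" "finite A" "finite B" "card A = q" "card B = q"
    "A \<union> B = {e \<in> edges X. v \<in> ends X e}"
    "\<And>e f. (\<exists>c. cell_corner p X c v e f) \<longleftrightarrow> e \<in> A \<and> f \<in> B \<or> e \<in> B \<and> f \<in> A"
proof -
  obtain A B where AB: "A \<inter> B = {}" "A \<union> B = link_nodes X v" "finite (link_nodes X v)"
    "card A = q" "card B = q"
    "\<forall>x\<in>link_nodes X v. \<forall>y\<in>link_nodes X v.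
       link_adj p X v x y \<longleftrightarrow> (x \<in> A \<and> y \<in> B) \<or> (x \<in> B \<and> y \<in> A)"
    using links[OF assms] unfolding is_complete_bipartite_def by metis
  have N: "e \<in> link_nodes X v \<and> f \<in> link_nodes X v" if "cell_corner p X c v e f" for c e f
    using that cell_corner_incident cell_corner_sym unfolding link_nodes_def by blast
  show thesis
  proof (rule that[of A B])
    show "finite A" "finite B" using AB by (metis finite_Un)+
    show "(\<exists>c. cell_corner p X c v e f) \<longleftrightarrow> e \<in> A \<and> f \<in> B \<or> e \<in> B \<and> f \<in> A" for e f
      using AB N unfolding link_adj_cell_corner by blast
  qed (use AB in \<open>auto simp: link_nodes_def\<close>)
qed

lemma cell_corner_bipartition:
  assumes "cell_corner p X c v a b"
  obtains A B where "A \<inter> B = {}"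
    "\<And>e f. (\<exists>c. cell_corner p X c v e f) \<longleftrightarrow> e \<in> A \<and> f \<in> B \<or> e \<in> B \<and> f \<in> A"
  by (rule link_bipartition[OF cell_corner_incident(1)[OF assms]]) (rule that)

sublocale chamber_system "cells X" "sides p X" "cell_corner p X"
proof
  show "cell_corner p X c v e f \<Longrightarrow> c' \<in> cells X \<Longrightarrow> e \<in> sides p X c' \<Longrightarrow> \<exists>g. cell_corner p X c' v e g"
    for c v e f c'
    using cell_corner_ex cell_corner_incident(3) by metis
next
  fix c v a b d b' u a'
  assume *: "cell_corner p X c v a b" "cell_corner p X d v a b'" "cell_corner p X u v a' b'"
  obtain A B where "A \<inter> B = {}" and AB: "\<And>e f. (\<exists>c. cell_corner p X c v e f) \<longleftrightarrow> e \<in> A \<and> f \<in> B \<or> e \<in> B \<and> f \<in> A"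
    by (rule cell_corner_bipartition[OF *(1)]) (rule that)
  then show "\<exists>y. cell_corner p X y v a' b" using * by (metis disjoint_iff)
next
  fix c v a b d b' x
  assume *: "cell_corner p X c v a b" "cell_corner p X d v a b'"
  obtain A B where "A \<inter> B = {}" and AB: "\<And>e f. (\<exists>c. cell_corner p X c v e f) \<longleftrightarrow> e \<in> A \<and> f \<in> B \<or> e \<in> B \<and> f \<in> A"
    by (rule cell_corner_bipartition[OF *(1)]) (rule that)
  then show "\<not> cell_corner p X x v b b'" using * by (metis disjoint_iff)
next
  fix c v a b u a' b'
  assume *: "cell_corner p X c v a b" "cell_corner p X u v a' b'"
  obtain A B where "A \<inter> B = {}" and AB: "\<And>e f. (\<exists>c. cell_corner p X c v e f) \<longleftrightarrow> e \<in> A \<and> f \<in> B \<or> e \<in> B \<and> f \<in> A"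
    by (rule cell_corner_bipartition[OF *(1)]) (rule that)
  then show "(\<exists>x. cell_corner p X x v a b') \<or> (\<exists>x. cell_corner p X x v a a')" using * by metis
qed (fact cell_corner_sym cell_corner_cell cell_corner_neq cell_corner_edges cell_corner_unique
      side_unique cell_corner_no_triangle)+

text \<open>At an end \<open>v\<close> of \<open>e\<close>, a chamber on \<open>e\<close>
  corresponds to its second side at \<open>v\<close>. These second sides are the link neighbours of
  \<open>e\<close>, which form one whole class of \<open>K(q,q)\<close>.\<close>

lemma card_cells_at_edge:
  assumes "c \<in> cells X" "e \<in> sides p X c"
  shows "finite {c \<in> cells X. e \<in> sides p X c}" "card {c \<in> cells X. e \<in> sides p X c} = q"
proof -
  obtain i where i: "i < p" "e = side X c i" using assms unfolding sides_def by blast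
  define v where "v = corner X c i"
  have v: "v \<in> verts X" "v \<in> ends X e" using i assms corner_vert ends_side unfolding v_def by auto
  obtain A B where AB: "A \<inter> B = {}" "finite A" "finite B" "card A = q" "card B = q"
    "A \<union> B = {e \<in> edges X. v \<in> ends X e}"
    "\<And>e f. (\<exists>c. cell_corner p X c v e f) \<longleftrightarrow> e \<in> A \<and> f \<in> B \<or> e \<in> B \<and> f \<in> A"
    by (rule link_bipartition[OF v(1)]) (rule that)
  define F where "F = {f. \<exists>c. cell_corner p X c v e f}"
  have "e \<in> A \<union> B" using AB(6) v i assms side_edge by auto
  then have "F = A \<or> F = B" unfolding F_def AB(7) using AB(1) by auto
  then have F: "finite F" "card F = q" using AB by auto
  define g where "g c = (THE f. cell_corner p X c v e f)" for c
  have g: "cell_corner p X c v e (g c)" if c: "c \<in> cells X" "e \<in> sides p X c" for c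
  proof -
    obtain f where f: "cell_corner p X c v e f" using cell_corner_ex c v by blast
    then show ?thesis unfolding g_def using cor_other by (metis the_equality)
  qed
  have "bij_betw g {c \<in> cells X. e \<in> sides p X c} F"
  proof (rule bij_betw_imageI)
    show "inj_on g {c \<in> cells X. e \<in> sides p X c}"
    proof (rule inj_onI)
      fix x y assume "x \<in> {c \<in> cells X. e \<in> sides p X c}" "y \<in> {c \<in> cells X. e \<in> sides p X c}" "g x = g y"
      then show "x = y" using g[of x] g[of y] cell_corner_unique[of x v e "g x" y v] by simp
    qed
    show "g ` {c \<in> cells X. e \<in> sides p X c} = F"
    proof (intro equalityI subsetI)
      fix f assume "f \<in> F"
      then obtain c where c: "cell_corner p X c v e f" unfolding F_def by blast
      then have "c \<in> cells X" "e \<in> sides p X c" using cell_corner_cell by auto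
      moreover from this have "f = g c" using g c cor_other by blast
      ultimately show "f \<in> g ` {c \<in> cells X. e \<in> sides p X c}" by blast
    qed (auto simp: F_def intro: g)
  qed
  then show "finite {c \<in> cells X. e \<in> sides p X c}" "card {c \<in> cells X. e \<in> sides p X c} = q"
    using F bij_betw_finite bij_betw_same_card by blast+
qed

subsection \<open>Lifting edge paths\<close>

lemma ends_vert: "e \<in> edges X \<Longrightarrow> ends X e \<subseteq> verts X"
  using polygonal unfolding polygonal_def by blast

definition at_corner :: "'c \<Rightarrow> 'c list \<Rightarrow> 'v \<Rightarrow> bool" where
  "at_corner c0 r v \<longleftrightarrow> red c0 r \<and> (\<exists>a b. cell_corner p X (hd r) v a b)"

lemma at_cornerE:
  assumes "at_corner c0 r v" obtains a b where "red c0 r" "cell_corner p X (hd r) v a b"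
  using assms unfolding at_corner_def by blast

lemma vres_at_corner: "at_corner c0 r v \<Longrightarrow> vres c0 v r r' \<Longrightarrow> at_corner c0 r' v"
  unfolding at_corner_def using vres_red vres_corner by blast

lemma vres_refl: "red c0 r \<Longrightarrow> vres c0 v r r"
  using vres.eq sweq.refl by blast

text \<open>Path lifting; a lift of a vertex \<open>v\<close> is represented by a chamber of the covering at it, and
  representatives may be changed along \<open>vres\<close>.\<close>

fun plift :: "'c \<Rightarrow> 'v \<Rightarrow> 'c list \<Rightarrow> ('v \<times> 'e \<times> 'v) list \<Rightarrow> 'v \<Rightarrow> 'c list \<Rightarrow> bool" where
  "plift c0 v r [] w r' \<longleftrightarrow> v = w \<and> vres c0 v r r'"
| "plift c0 v r ((a, e, b) # ds) w r' \<longleftrightarrow> v = a \<and> ends X e = {a, b} \<and>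
     (\<exists>r1 f. vres c0 v r r1 \<and> cell_corner p X (hd r1) a e f \<and> plift c0 b r1 ds w r')"

lemma plift_start: "vres c0 v s r \<Longrightarrow> plift c0 v r ds w r' \<Longrightarrow> plift c0 v s ds w r'"
proof (cases ds)
  case (Cons d ds')
  assume "vres c0 v s r" "plift c0 v r ds w r'"
  then show ?thesis using Cons by (cases d) (auto intro: vres.trans)
qed (auto intro: vres.trans)

lemma plift_end: "plift c0 v r ds w r' \<Longrightarrow> vres c0 w r' r'' \<Longrightarrow> plift c0 v r ds w r''"
  by (induction c0 v r ds w r' rule: plift.induct) (auto intro: vres.trans)

lemma other_end:
  assumes "cell_corner p X c a e f" "ends X e = {a, b}"
  shows "\<exists>g. cell_corner p X c b e g"
  using cell_corner_ex[of c e b] cell_corner_cell[OF assms(1)] assms(2) by auto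

text \<open>Representatives may differ at each edge, but \<open>vres_edge\<close> carries their
  agreement from one end of the edge to the other.\<close>

lemma plift_unique:
  "plift c0 v r ds w r' \<Longrightarrow> plift c0 v r ds w' r'' \<Longrightarrow> w = w' \<and> vres c0 w r' r''"
proof (induction ds arbitrary: v r)
  case Nil
  then have "v = w" "v = w'" "vres c0 v r r'" "vres c0 v r r''" by auto
  then show ?case using vres.trans[OF vres.sym] by metis
next
  case (Cons d ds)
  obtain a e b where d: "d = (a, e, b)" by (cases d)
  from Cons.prems(1) d obtain r1 f where 1: "v = a" "ends X e = {a, b}" "vres c0 v r r1"
    "cell_corner p X (hd r1) a e f" "plift c0 b r1 ds w r'" by auto
  from Cons.prems(2) d obtain r2 f2 where 2: "vres c0 v r r2"
    "cell_corner p X (hd r2) a e f2" "plift c0 b r2 ds w' r''" by auto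
  have v: "vres c0 a r1 r2" using vres.trans[OF vres.sym[OF 1(3)] 2(1)] 1(1) by simp
  obtain g where "cell_corner p X (hd r1) b e g" using other_end 1 by blast
  then have "vres c0 b r1 r2" using vres_edge[OF v 1(4) 2(2)] by blast
  then have "plift c0 b r1 ds w' r''" using plift_start 2(3) by blast
  then show ?case using Cons.IH 1(5) by blast
qed

lemma plift_append: "plift c0 u r xs m k \<Longrightarrow> plift c0 m k ys w r' \<Longrightarrow> plift c0 u r (xs @ ys) w r'"
proof (induction c0 u r xs m k rule: plift.induct)
  case (1 c0 v r w r')
  then show ?case using plift_start by auto
qed auto

lemma plift_appendE:
  assumes "plift c0 u r (xs @ ys) w r'" "at_corner c0 r u"
  obtains m k where "plift c0 u r xs m k" "plift c0 m k ys w r'"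
proof -
  have "\<exists>m k. plift c0 u r xs m k \<and> plift c0 m k ys w r'" using assms
  proof (induction xs arbitrary: u r)
    case Nil
    then show ?case using vres_refl unfolding at_corner_def by auto
  next
    case (Cons d xs)
    obtain a e b where d: "d = (a, e, b)" by (cases d)
    from Cons.prems(1) d obtain r1 f where 1: "u = a" "ends X e = {a, b}" "vres c0 u r r1"
      "cell_corner p X (hd r1) a e f" "plift c0 b r1 (xs @ ys) w r'" by auto
    then have "at_corner c0 r1 b" using other_end vres_red unfolding at_corner_def by blast
    then obtain m k where "plift c0 b r1 xs m k" "plift c0 m k ys w r'" using Cons.IH 1 by blast
    then show ?case using 1 d by auto
  qed
  then show thesis using that by blast
qed

lemma plift_at_corner: "plift c0 v r ds w r' \<Longrightarrow> at_corner c0 r v \<Longrightarrow> at_corner c0 r' w"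
proof (induction c0 v r ds w r' rule: plift.induct)
  case (1 c0 v r w r')
  then show ?case using vres_at_corner by auto
next
  case (2 c0 v r a e b ds w r')
  then obtain r1 f where 1: "v = a" "ends X e = {a, b}" "vres c0 v r r1"
      "cell_corner p X (hd r1) a e f" "plift c0 b r1 ds w r'" by auto
  then have "at_corner c0 r1 b" using other_end vres_red unfolding at_corner_def by blast
  then show ?case using 2 1 by blast
qed

lemma plift_edge_path: "plift c0 v r ds w r' \<Longrightarrow> at_corner c0 r v \<Longrightarrow> edge_path X v ds w"
proof (induction c0 v r ds w r' rule: plift.induct)
  case (1 c0 v r w r')
  then show ?case using cell_corner_incident unfolding at_corner_def by auto
next
  case (2 c0 v r a e b ds w r')
  then obtain r1 f where 1: "v = a" "ends X e = {a, b}" "vres c0 v r r1"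
      "cell_corner p X (hd r1) a e f" "plift c0 b r1 ds w r'" by auto
  then have "at_corner c0 r1 b" using other_end vres_red unfolding at_corner_def by blast
  then show ?case using 2 1 cell_corner_incident by auto
qed

lemma edge_at_vertex:
  assumes c: "cell_corner p X c v a b" and e: "e \<in> edges X" "v \<in> ends X e"
  shows "\<exists>x f. cell_corner p X x v e f"
proof (rule link_bipartition[OF cell_corner_incident(1)[OF c]])
  fix A B
  assume AB: "A \<union> B = {e \<in> edges X. v \<in> ends X e}"
    "\<And>e f. (\<exists>c. cell_corner p X c v e f) \<longleftrightarrow> e \<in> A \<and> f \<in> B \<or> e \<in> B \<and> f \<in> A"
  then have "e \<in> A \<or> e \<in> B" using e by blast
  moreover have "a \<in> A \<and> b \<in> B \<or> a \<in> B \<and> b \<in> A" using AB(2) c by blast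
  ultimately show ?thesis using AB(2) by meson
qed

lemma step_lift:
  assumes r: "at_corner c0 r v" and e: "e \<in> edges X" "v \<in> ends X e"
  obtains r1 f where "vres c0 v r r1" "cell_corner p X (hd r1) v e f"
proof -
  obtain a b where ab: "red c0 r" "cell_corner p X (hd r) v a b" using r by (rule at_cornerE)
  obtain x f where x: "cell_corner p X x v e f" using edge_at_vertex[OF ab(2) e] by blast
  then show thesis using that vres_ex[OF ab x] by blast
qed

lemma plift_ex: "edge_path X v ds w \<Longrightarrow> at_corner c0 r v \<Longrightarrow> \<exists>r'. plift c0 v r ds w r'"
proof (induction ds arbitrary: v r)
  case Nil
  then show ?case using vres_refl unfolding at_corner_def by auto
next
  case (Cons d ds)
  obtain a e b where d: "d = (a, e, b)" by (cases d)
  then have e: "v = a" "e \<in> edges X" "ends X e = {a, b}" "edge_path X b ds w" using Cons.prems by auto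
  obtain r1 f where r1: "vres c0 v r r1" "cell_corner p X (hd r1) v e f"
    using step_lift[OF Cons.prems(2) e(2)] e by auto
  then have "at_corner c0 r1 b" using other_end vres_red e unfolding at_corner_def by blast
  then obtain r' where "plift c0 b r1 ds w r'" using Cons.IH e by blast
  then show ?case using d e r1 by auto
qed

lemma plift_rev:
  "plift c0 v r ds w r' \<Longrightarrow> at_corner c0 r v \<Longrightarrow>
     plift c0 w r' (rev (map (\<lambda>(a, e, b). (b, e, a)) ds)) v r"
proof (induction c0 v r ds w r' rule: plift.induct)
  case (1 c0 v r w r')
  then show ?case by (auto intro: vres.sym)
next
  case (2 c0 v r a e b ds w r')
  then obtain r1 f where 1: "v = a" "ends X e = {a, b}" "vres c0 v r r1"
      "cell_corner p X (hd r1) a e f" "plift c0 b r1 ds w r'" by auto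
  obtain g where g: "cell_corner p X (hd r1) b e g" using other_end 1 by blast
  have red: "red c0 r1" using 1 vres_red by blast
  then have "at_corner c0 r1 b" using g unfolding at_corner_def by blast
  then have "plift c0 w r' (rev (map (\<lambda>(a, e, b). (b, e, a)) ds)) b r1" using 2 1 by blast
  moreover have "plift c0 b r1 [(b, e, a)] v r"
    using g 1 vres_refl[OF red] vres.sym[OF 1(3)] by (auto simp: insert_commute)
  ultimately show ?case using plift_append by auto
qed

lemma plift_backtrack:
  assumes r: "at_corner c0 r a" and e: "e \<in> edges X" "ends X e = {a, b}"
  shows "plift c0 a r [(a, e, b), (b, e, a)] a r"
proof -
  obtain r1 f where r1: "vres c0 a r r1" "cell_corner p X (hd r1) a e f"
    using step_lift[OF r e(1)] e(2) by auto
  obtain g where g: "cell_corner p X (hd r1) b e g" using other_end[OF r1(2) e(2)] by blast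
  have red: "red c0 r1" using r1 vres_red by blast
  then show ?thesis
    using r1 g e vres_refl[OF red] vres.sym[OF r1(1)] by (auto simp: insert_commute)
qed

text \<open>While the path runs along the boundary of \<open>hd r\<close>, the same \<open>r\<close>
  represents every lifted vertex. The length \<open>n\<close> is free so that both a full loop and a
  walk between two corners are covered.\<close>

lemma plift_walk:
  assumes r: "red c0 r" "hd r = c"
  shows "plift c0 (corner X c (i mod p)) r
     (map (\<lambda>j. (corner X c ((i + j) mod p), side X c ((i + j) mod p), corner X c (Suc (i + j) mod p))) [0..<n])
     (corner X c ((i + n) mod p)) r"
proof (induction n)
  case 0
  show ?case using vres_refl[OF r(1)] by simp
next
  case (Suc n)
  have c: "c \<in> cells X" using red_hd r by blast
  let ?k = "(i + n) mod p"
  have k: "?k < p" using p by simp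
  have ends: "ends X (side X c ?k) = {corner X c ?k, corner X c (Suc (i + n) mod p)}"
    using ends_side[OF c k] by (simp add: mod_Suc_eq)
  have "side X c ?k \<in> sides p X c" using k unfolding sides_def by blast
  then obtain f where "cell_corner p X c (corner X c ?k) (side X c ?k) f"
    using cell_corner_ex[OF c] ends by blast
  then have "plift c0 (corner X c ?k) r
     [(corner X c ?k, side X c ?k, corner X c (Suc (i + n) mod p))] (corner X c (Suc (i + n) mod p)) r"
    using ends vres_refl[OF r(1)] r(2) by auto
  then show ?case using plift_append[OF Suc.IH] by simp
qed

lemma plift_within_cell:
  assumes r: "red c0 r" and v: "cell_corner p X (hd r) v a b" and w: "cell_corner p X (hd r) w a' b'"
  shows "\<exists>ds. plift c0 v r ds w r"
proof -
  obtain i where i: "i < p" "v = corner X (hd r) (i mod p)" 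
    using v p by (elim cell_cornerE) (metis mod_less_divisor mod_mod_trivial zero_less_numeral order_less_le_trans)
  obtain j where j: "j < p" "w = corner X (hd r) (j mod p)" 
    using w p by (elim cell_cornerE) (metis mod_less_divisor mod_mod_trivial zero_less_numeral order_less_le_trans)
  \<comment> \<open>The summand \<open>p\<close> keeps the number of steps from \<open>i\<close> to
    \<open>j\<close> from being truncated at zero.\<close>
  have "(i + (j + p - i)) mod p = j mod p" using i(1) by simp
  then show ?thesis using plift_walk[OF r HOL.refl, of i "j + p - i"] i j by metis
qed

lemma plift_cell_loop:
  assumes r: "at_corner c0 r (corner X c i)" and c: "c \<in> cells X" "i < p"
  shows "plift c0 (corner X c i) r (cell_loop p X c i) (corner X c i) r"
proof -
  obtain a b where ab: "red c0 r" "cell_corner p X (hd r) (corner X c i) a b" using r by (rule at_cornerE)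
  have "side X c i \<in> sides p X c" "corner X c i \<in> ends X (side X c i)"
    using c ends_side unfolding sides_def by auto
  then obtain f where "cell_corner p X c (corner X c i) (side X c i) f" using cell_corner_ex c by blast
  then obtain r1 where r1: "vres c0 (corner X c i) r r1" "hd r1 = c" using vres_ex[OF ab] by blast
  have "plift c0 (corner X c (i mod p)) r1 (cell_loop p X c i) (corner X c ((i + p) mod p)) r1"
    unfolding cell_loop_def using plift_walk[OF _ r1(2)] vres_red r1(1) by blast
  then have "plift c0 (corner X c i) r1 (cell_loop p X c i) (corner X c i) r1" using c by simp
  then show ?thesis using plift_start[OF r1(1)] plift_end vres.sym[OF r1(1)] by blast
qed

text \<open>Both elementary homotopies insert a closed path \<open>L\<close> all of whose lifts are
  closed; unique lifting then lets \<open>L\<close> be inserted or dropped.\<close>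

lemma plift_insert:
  assumes r: "at_corner c0 r u" and xs: "edge_path X u xs m"
    and L: "\<And>k. at_corner c0 k m \<Longrightarrow> plift c0 m k L m k"
  shows "plift c0 u r (xs @ ys) w r' \<longleftrightarrow> plift c0 u r (xs @ L @ ys) w r'"
proof
  assume "plift c0 u r (xs @ ys) w r'"
  then obtain m' k where k: "plift c0 u r xs m' k" "plift c0 m' k ys w r'" using r by (rule plift_appendE)
  then have "m' = m" using edge_path_end_unique[OF plift_edge_path[OF k(1) r] xs] by blast
  then show "plift c0 u r (xs @ L @ ys) w r'" using k L plift_append plift_at_corner r by metis
next
  assume "plift c0 u r (xs @ L @ ys) w r'"
  then obtain m' k where k: "plift c0 u r xs m' k" "plift c0 m' k (L @ ys) w r'" using r by (rule plift_appendE)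
  then have m: "m' = m" using edge_path_end_unique[OF plift_edge_path[OF k(1) r] xs] by blast
  have km: "at_corner c0 k m" using plift_at_corner k m r by blast
  obtain m'' k' where k': "plift c0 m k L m'' k'" "plift c0 m'' k' ys w r'"
    using plift_appendE k(2) m km by blast
  then have "m'' = m" "vres c0 m k k'" using plift_unique L[OF km] by blast+
  then show "plift c0 u r (xs @ ys) w r'" using k m k' plift_append plift_start by metis
qed

lemma plift_elementary_homotopy:
  assumes h: "elementary_homotopy p X u v ds ds'" and r: "at_corner c0 r u"
  shows "plift c0 u r ds w r' \<longleftrightarrow> plift c0 u r ds' w r'"
proof -
  have u: "u \<in> verts X" using r cell_corner_incident unfolding at_corner_def by blast
  show ?thesis using h
  proof cases
    case (backtrack xs a e b ys)
    obtain m where m: "edge_path X u xs m" "edge_path X m ([(a, e, b), (b, e, a)] @ ys) v"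
      using edge_path_append[OF backtrack(3) u ends_vert] by blast
    then have "m = a" "e \<in> edges X" "ends X e = {a, b}" by auto
    then show ?thesis using plift_insert[OF r m(1)] plift_backtrack backtrack by metis
  next
    case (cell xs c i ys)
    obtain m where m: "edge_path X u xs m" "edge_path X m (cell_loop p X c i @ ys) v"
      using edge_path_append[OF cell(3) u ends_vert] by blast
    have "[0..<p] = 0 # [1..<p]" using p by (simp add: upt_conv_Cons)
    then have "m = corner X c i" using m(2) cell(5) unfolding cell_loop_def by simp
    then show ?thesis using plift_insert[OF r m(1)] plift_cell_loop cell by metis
  qed
qed

text \<open>Trivial monodromy: the end of a lift is a homotopy invariant, and simple connectedness
  contracts \<open>ds\<close> to the empty path.\<close>

lemma plift_closed:
  assumes ds: "edge_path X u ds u" and r: "at_corner c0 r u"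
  shows "plift c0 u r ds u r"
proof -
  have u: "u \<in> verts X" using r cell_corner_incident unfolding at_corner_def by blast
  have "equivclp (elementary_homotopy p X u u) ds []"
    using sc u ds unfolding simply_connected_complex_def homotopic_edge_paths_def by blast
  then have "plift c0 u r ds u r \<longleftrightarrow> plift c0 u r [] u r"
    by (rule equivclp_invariant) (rule plift_elementary_homotopy[OF _ r])
  then show ?thesis using r vres_refl unfolding at_corner_def by auto
qed

section \<open>Connectedness and triviality of the covering\<close>

lemma red_start: "red c0 r \<Longrightarrow> red c0 [c0]"
  by (induction rule: red.induct) (auto intro: red.start)

text \<open>The path follows the gallery. Each step is made at an end \<open>w\<close> of the common
  side, where \<open>r\<close> and \<open>c # r\<close> represent the same lifted vertex, so only
  the representative changes.\<close>

lemma plift_red: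
  assumes "red c0 r" "cell_corner p X c0 v0 a0 b0" "cell_corner p X (hd r) v a b"
  shows "\<exists>ds. plift c0 v0 [c0] ds v r"
  using assms
proof (induction arbitrary: v a b rule: red.induct)
  case start
  then show ?case using plift_within_cell[of c0 "[c0]"] red.start by auto
next
  case (step r e c)
  have e: "c \<in> cells X" "hd r \<in> cells X" "e \<in> sides p X c" "e \<in> sides p X (hd r)"
    using step.hyps unfolding pan_def by auto
  obtain w where w: "w \<in> ends X e" using e ends_side unfolding sides_def by blast
  obtain f f' where f: "cell_corner p X (hd r) w e f" "cell_corner p X c w e f'"
    using cell_corner_ex e w by metis
  obtain ds where ds: "plift c0 v0 [c0] ds w r" using step.IH f step.prems by blast
  have "vres c0 w r (c # r)" using vres.up step.hyps f by blast
  then have 1: "plift c0 v0 [c0] ds w (c # r)" using ds plift_end by blast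
  have "red c0 (c # r)" using step.hyps red.step by blast
  then obtain ds' where "plift c0 w (c # r) ds' v (c # r)"
    using plift_within_cell[of c0 "c # r" w e f' v] f(2) step.prems(2) unfolding list.sel by blast
  then show ?case using plift_append 1 by blast
qed

lemma cell_corner_exists:
  assumes "c \<in> cells X" shows "\<exists>v a b. cell_corner p X c v a b"
  using assms p unfolding cell_corner_def by (metis less_le_trans zero_less_numeral)

text \<open>A path traced back along \<open>r\<close> to \<open>c0\<close> and then out along
  \<open>r'\<close> is closed in the complex because the end chambers agree. So its lift closes too,
  and \<open>r\<close>, \<open>r'\<close> share a lift of \<open>v\<close>.\<close>

lemma red_unique:
  assumes "red c0 r" "red c0 r'" "hd r = hd r'"
  shows "sweq r r'"
proof -
  have c0: "red c0 [c0]" "c0 \<in> cells X" using red_start assms red_hd by fastforce+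
  obtain v0 a0 b0 where v0: "cell_corner p X c0 v0 a0 b0" using cell_corner_exists c0 by blast
  obtain v a b where v: "cell_corner p X (hd r) v a b" using cell_corner_exists red_hd assms by blast
  have at0: "at_corner c0 [c0] v0" using c0 v0 unfolding at_corner_def by auto
  have at: "at_corner c0 r v" "at_corner c0 r' v" using assms v unfolding at_corner_def by auto
  obtain ds where ds: "plift c0 v0 [c0] ds v r" using plift_red assms(1) v0 v by blast
  obtain ds' where ds': "plift c0 v0 [c0] ds' v r'" using plift_red assms(2,3) v0 v by metis
  let ?rev = "rev (map (\<lambda>(a, e, b). (b, e, a)) ds)"
  have rev: "plift c0 v r ?rev v0 [c0]" using plift_rev[OF ds at0] .
  have "plift c0 v r (?rev @ ds') v r'" using plift_append rev ds' by blast
  moreover from this have "plift c0 v r (?rev @ ds') v r" using plift_closed plift_edge_path at by blast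
  ultimately have "vres c0 v r r'" using plift_unique by blast
  then show ?thesis using vres_unique v assms(3) by blast
qed

lemma red_exists:
  assumes "c0 \<in> cells X" "c \<in> cells X"
  shows "\<exists>r. red c0 r \<and> hd r = c"
proof -
  have c0: "red c0 [c0]" using red.start assms by blast
  obtain v0 a0 b0 where v0: "cell_corner p X c0 v0 a0 b0" using cell_corner_exists assms by blast
  obtain v a b where v: "cell_corner p X c v a b" using cell_corner_exists assms by blast
  have at0: "at_corner c0 [c0] v0" using c0 v0 unfolding at_corner_def by auto
  obtain ds where "edge_path X v0 ds v"
    using sc cell_corner_incident(1)[OF v0] cell_corner_incident(1)[OF v]
    unfolding simply_connected_complex_def by blast
  then obtain r where r: "plift c0 v0 [c0] ds v r" using plift_ex at0 by blast
  then have "at_corner c0 r v" using plift_at_corner at0 by blast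
  then obtain a' b' where "red c0 r" "cell_corner p X (hd r) v a' b'" by (rule at_cornerE)
  then show ?thesis using vres_ex[OF _ _ v] vres_red by blast
qed

subsection \<open>Layers\<close>

lemma chamber_adj_pan: "chamber_adj p X c c' \<longleftrightarrow> (\<exists>e. pan e c c')"
  unfolding chamber_adj_def pan_def by blast

lemma chamber_adj_sym: "chamber_adj p X c c' \<longleftrightarrow> chamber_adj p X c' c"
  unfolding chamber_adj_def by blast

lemma red_gallery: "red c0 r \<Longrightarrow> (chamber_adj p X ^^ (length r - 1)) c0 (hd r)"
proof (induction rule: red.induct)
  case (step r e c)
  then have "length r = Suc (length r - 1)" using red_not_Nil by fastforce
  moreover have "chamber_adj p X (hd r) c" using step.hyps pan_sym chamber_adj_pan by blast
  ultimately show ?case using relpowp_Suc_I[OF step.IH] by (metis diff_Suc_1 length_Cons list.sel(1))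
qed simp

lemma gallery_red:
  "(chamber_adj p X ^^ n) c0 c \<Longrightarrow> c0 \<in> cells X \<Longrightarrow> \<exists>r. red c0 r \<and> hd r = c \<and> length r \<le> Suc n"
proof (induction n arbitrary: c)
  case 0
  then show ?case using red.start[of c0] by (intro exI[of _ "[c0]"]) auto
next
  case (Suc n)
  obtain d where d: "(chamber_adj p X ^^ n) c0 d" "chamber_adj p X d c"
    using Suc.prems(1) by (rule relpowp_Suc_E)
  then obtain r e where "red c0 r" "hd r = d" "length r \<le> Suc n" "pan e c d"
    using Suc chamber_adj_pan pan_sym by metis
  then show ?case using red_neighbour by (meson Suc_le_mono order_trans)
qed

text \<open>A shortest gallery yields a reduced one that is no longer, and all reduced galleries
  with the same end have equal length. Lists count chambers rather than steps, hence the
  \<open>Suc\<close>.\<close>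

lemma layer_red:
  assumes r: "red c0 r" shows "length r = Suc (layer p X c0 (hd r))"
proof -
  have c0: "c0 \<in> cells X" using red_start[OF r] red_hd by fastforce
  have "(chamber_adj p X ^^ layer p X c0 (hd r)) c0 (hd r)"
    unfolding layer_def by (rule LeastI) (rule red_gallery[OF r])
  then obtain r' where r': "red c0 r'" "hd r' = hd r" "length r' \<le> Suc (layer p X c0 (hd r))"
    using gallery_red c0 by blast
  have "length r' = length r" using red_unique[OF r'(1) r r'(2)] sweq_length by blast
  moreover have "layer p X c0 (hd r) \<le> length r - 1"
    unfolding layer_def by (rule Least_le) (rule red_gallery[OF r])
  moreover have "length r > 0" using red_not_Nil[OF r] by simp
  ultimately show ?thesis using r' by linarith
qed

lemma layer_adj:
  assumes "c0 \<in> cells X" "chamber_adj p X c c'"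
  shows "layer p X c0 c' \<le> Suc (layer p X c0 c)"
proof -
  have "c \<in> cells X" using assms(2) unfolding chamber_adj_def by blast
  then obtain r where r: "red c0 r" "hd r = c" using red_exists assms by blast
  then obtain e where "pan e c' (hd r)" using assms(2) chamber_adj_pan pan_sym by blast
  then obtain r' where "red c0 r'" "hd r' = c'" "length r' \<le> Suc (length r)"
    using red_neighbour r by blast
  then show ?thesis using layer_red r by fastforce
qed

lemma card_panel:
  assumes "c \<in> cells X" "e \<in> sides p X c"
  shows "finite {c'. pan e c c'}" "card {c'. pan e c c'} = q - 1"
proof -
  have "{c'. pan e c c'} = {c \<in> cells X. e \<in> sides p X c} - {c}"
    using assms unfolding pan_def by blast
  then show "finite {c'. pan e c c'}" "card {c'. pan e c c'} = q - 1"
    using card_cells_at_edge[OF assms] assms by auto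
qed

lemma card_neighbours:
  assumes "c \<in> cells X"
  shows "finite {c'. chamber_adj p X c c'}" "card {c'. chamber_adj p X c c'} = p * (q - 1)"
proof -
  have eq: "{c'. chamber_adj p X c c'} = (\<Union>e\<in>sides p X c. {c'. pan e c c'})"
    unfolding chamber_adj_pan by (auto simp: pan_def)
  have fin: "finite (sides p X c)" unfolding sides_def by simp
  have "card (sides p X c) = p"
    unfolding sides_def using side_inj[OF assms] by (subst card_image) (auto intro: inj_onI)
  moreover have "card (\<Union>e\<in>sides p X c. {c'. pan e c c'}) = (\<Sum>e\<in>sides p X c. card {c'. pan e c c'})"
    by (rule card_UN_disjoint) (use fin card_panel[OF assms] pan_unique in auto)
  ultimately show "card {c'. chamber_adj p X c c'} = p * (q - 1)"
    using card_panel[OF assms] unfolding eq by simp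
  show "finite {c'. chamber_adj p X c c'}" unfolding eq using fin card_panel[OF assms] by blast
qed

lemma card_descents:
  assumes "red c0 r"
  shows "finite {e. descent r e}" "card {e. descent r e} \<le> 2"
proof -
  have "{e. descent r e} \<subseteq> sides p X (hd r)" unfolding descent_def pan_def by blast
  then show fin: "finite {e. descent r e}" using finite_subset unfolding sides_def by blast
  show "card {e. descent r e} \<le> 2"
  proof (rule ccontr)
    assume "\<not> card {e. descent r e} \<le> 2"
    then obtain S where S: "S \<subseteq> {e. descent r e}" "card S = 3"
      using obtain_subset_with_card_n[of 3 "{e. descent r e}"] by (metis not_less_eq_eq numeral_2_eq_2 numeral_3_eq_3)
    then obtain e f g where "S = {e, f, g}" "e \<noteq> f" "e \<noteq> g" "f \<noteq> g" unfolding card_3_iff by blast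
    then show False using S(1) no_three_descents[of r e f g] by simp
  qed
qed

text \<open>A neighbour across a side that is no descent prolongs the reduced gallery and lies one
  layer further out. Neighbours in the same layer are counted as well, since the order of
  contraction may put them before \<open>c\<close>.\<close>

lemma card_lower_neighbours:
  assumes "c0 \<in> cells X" "c \<in> cells X"
  shows "card {c'. chamber_adj p X c c' \<and> layer p X c0 c' \<le> layer p X c0 c} \<le> 2 * (q - 1)"
proof -
  obtain r where r: "red c0 r" "hd r = c" using red_exists assms by blast
  let ?D = "{e. descent r e}"
  have D: "?D \<subseteq> sides p X c" using r unfolding descent_def pan_def by blast
  have sub: "{c'. chamber_adj p X c c' \<and> layer p X c0 c' \<le> layer p X c0 c} \<subseteq> (\<Union>e\<in>?D. {c'. pan e c c'})"
  proof
    fix c' assume "c' \<in> {c'. chamber_adj p X c c' \<and> layer p X c0 c' \<le> layer p X c0 c}"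
    then obtain e where e: "pan e c c'" "layer p X c0 c' \<le> layer p X c0 c"
      using chamber_adj_pan by blast
    have "descent r e"
    proof (rule ccontr)
      assume "\<not> descent r e"
      then have "red c0 (c' # r)" using red.step r e pan_sym by metis
      then show False using layer_red[of c0 "c' # r"] layer_red[OF r(1)] r e by simp
    qed
    then show "c' \<in> (\<Union>e\<in>?D. {c'. pan e c c'})" using e by blast
  qed
  have fin: "finite ?D" using card_descents r by blast
  have "card {c'. chamber_adj p X c c' \<and> layer p X c0 c' \<le> layer p X c0 c} \<le> card (\<Union>e\<in>?D. {c'. pan e c c'})"
    by (rule card_mono[OF _ sub]) (use fin D card_panel[OF assms(2)] in blast)
  also have "\<dots> \<le> (\<Sum>e\<in>?D. card {c'. pan e c c'})" by (rule card_UN_le[OF fin])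
  also have "\<dots> = (\<Sum>e\<in>?D. q - 1)" by (rule sum.cong) (use D card_panel[OF assms(2)] in auto)
  also have "\<dots> \<le> 2 * (q - 1)" using card_descents(2)[OF r(1)] by simp
  finally show ?thesis .
qed

text \<open>A chamber of layer \<open>n + 1\<close> adjoins one of layer \<open>n\<close>, and each
  chamber has finitely many neighbours. Without finiteness the product over the kept tensors would
  be the default value 1.\<close>

lemma finite_kept:
  assumes c0: "c0 \<in> cells X" shows "finite (kept p X c0 n)"
proof (induction n)
  case 0
  have "kept p X c0 0 \<subseteq> {c0}"
  proof
    fix c assume "c \<in> kept p X c0 0"
    then have c: "c \<in> cells X" "layer p X c0 c = 0" unfolding kept_def by auto
    obtain r where r: "red c0 r" "hd r = c" using red_exists c0 c by blast
    then have "length r = 1" using layer_red c by fastforce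
    then show "c \<in> {c0}" using red_gallery[OF r(1)] r by simp
  qed
  then show ?case using finite_subset by blast
next
  case (Suc n)
  have "kept p X c0 (Suc n) \<subseteq> kept p X c0 n \<union> (\<Union>d\<in>kept p X c0 n. {c. chamber_adj p X d c})"
  proof
    fix c assume "c \<in> kept p X c0 (Suc n)"
    then have c: "c \<in> cells X" "layer p X c0 c \<le> Suc n" unfolding kept_def by auto
    obtain r where r: "red c0 r" "hd r = c" using red_exists c0 c by blast
    from r(1) show "c \<in> kept p X c0 n \<union> (\<Union>d\<in>kept p X c0 n. {c. chamber_adj p X d c})"
    proof cases
      case start
      then have "layer p X c0 c = 0" using layer_red[OF r(1)] r by simp
      then show ?thesis using c unfolding kept_def by simp
    next
      case (step s e d)
      then have "c = d" using r by simp
      have "Suc (layer p X c0 (hd s)) = layer p X c0 c"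
        using layer_red[OF r(1)] layer_red[OF step(2)] r step(1) by simp
      then have "hd s \<in> kept p X c0 n" using c red_hd[OF step(2)] unfolding kept_def by simp
      moreover have "chamber_adj p X (hd s) c" using step(3) \<open>c = d\<close> chamber_adj_pan pan_sym by blast
      ultimately show ?thesis by blast
    qed
  qed
  moreover have "finite (kept p X c0 n \<union> (\<Union>d\<in>kept p X c0 n. {c. chamber_adj p X d c}))"
    using Suc card_neighbours(1) unfolding kept_def by auto
  ultimately show ?case using finite_subset by blast
qed

end

section \<open>Contraction of isometries\<close>

lemma configs_bij:
  assumes "A \<inter> B = {}"
  shows "bij_betw (merge A B) (configs d A \<times> configs d B) (configs d (A \<union> B))"
proof (rule bij_betw_byWitness[where f' = "\<lambda>w. (restrict w A, restrict w B)"])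
  show "\<forall>a\<in>configs d A \<times> configs d B. (restrict (merge A B a) A, restrict (merge A B a) B) = a"
    using assms by (auto simp: configs_def PiE_restrict)
  show "\<forall>w\<in>configs d (A \<union> B). merge A B (restrict w A, restrict w B) = w"
    by (auto simp: configs_def merge_def fun_eq_iff PiE_def extensional_def)
  show "merge A B ` (configs d A \<times> configs d B) \<subseteq> configs d (A \<union> B)"
    by (auto simp: configs_def merge_def PiE_def Pi_def extensional_def)
  show "(\<lambda>w. (restrict w A, restrict w B)) ` configs d (A \<union> B) \<subseteq> configs d A \<times> configs d B"
    by (auto simp: configs_def PiE_def Pi_def)
qed

lemma sum_configs_Un:
  assumes "A \<inter> B = {}"
  shows "(\<Sum>w\<in>configs d (A \<union> B). f w) = (\<Sum>x\<in>configs d A. \<Sum>y\<in>configs d B. f (merge A B (x, y)))"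
proof -
  have "(\<Sum>w\<in>configs d (A \<union> B). f w) = (\<Sum>xy\<in>configs d A \<times> configs d B. f (merge A B xy))"
    by (rule sum.reindex_bij_betw[OF configs_bij[OF assms], symmetric])
  then show ?thesis by (simp add: sum.cartesian_product case_prod_unfold)
qed

lemma tnorm_square: "(tnorm d A \<psi>)\<^sup>2 = (\<Sum>x\<in>configs d A. (cmod (\<psi> x))\<^sup>2)"
  unfolding tnorm_def L2_set_def by (simp add: sum_nonneg)

lemma tnorm_nonneg: "tnorm d A \<psi> \<ge> 0"
  unfolding tnorm_def by simp

text \<open>A network whose nodes are processed in the order of \<open>rank\<close>: a node consumes the wires \<open>In c\<close>
  and produces the wires \<open>Out c\<close>; \<open>A\<close> are the wires present at the start.\<close>

locale ordered_network =
  fixes d :: nat and K :: "'n set" and A :: "'w set" and In Out :: "'n \<Rightarrow> 'w set"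
    and S :: "'n \<Rightarrow> ('w \<Rightarrow> nat) \<Rightarrow> complex" and rank :: "'n \<Rightarrow> nat"
  assumes finite_nodes: "finite K"
    and inj_rank: "inj_on rank K"
    and In_disjoint: "c \<in> K \<Longrightarrow> c' \<in> K \<Longrightarrow> c \<noteq> c' \<Longrightarrow> In c \<inter> In c' = {}"
    and Out_disjoint: "c \<in> K \<Longrightarrow> c' \<in> K \<Longrightarrow> c \<noteq> c' \<Longrightarrow> Out c \<inter> Out c' = {}"
    and Out_initial: "c \<in> K \<Longrightarrow> Out c \<inter> A = {}"
    and In_available: "c \<in> K \<Longrightarrow> In c \<subseteq> A \<union> \<Union> (Out ` {c' \<in> K. rank c' < rank c})"
    and S_local: "c \<in> K \<Longrightarrow> (\<And>x. x \<in> In c \<union> Out c \<Longrightarrow> w x = w' x) \<Longrightarrow> S c w = S c w'"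
    and S_isometric: "c \<in> K \<Longrightarrow> \<exists>k>0. \<forall>\<phi>. (tnorm d (Out c) (tensor_map d (In c) (Out c) (S c) \<phi>))\<^sup>2
      = k * (tnorm d (In c) \<phi>)\<^sup>2"
begin

definition consumed :: "'n set \<Rightarrow> 'w set" where
  "consumed J = \<Union> (In ` J)"

definition current :: "'n set \<Rightarrow> 'w set" where
  "current J = A \<union> \<Union> (Out ` J) - consumed J"

text \<open>The vector on the wires still open after the nodes of \<open>J\<close> have acted on
  \<open>\<psi>\<close>. It is given in closed form rather than recursively, so that at
  \<open>J = K\<close> it can be compared with the contracted network. An initial wire may be
  consumed or still open, hence \<open>\<psi>\<close> reads the merged configuration.\<close>

definition state :: "(('w \<Rightarrow> nat) \<Rightarrow> complex) \<Rightarrow> 'n set \<Rightarrow> ('w \<Rightarrow> nat) \<Rightarrow> complex" where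
  "state \<psi> J y = (\<Sum>x\<in>configs d (consumed J).
     \<psi> (restrict (merge (consumed J) (current J) (x, y)) A) *
     (\<Prod>c\<in>J. S c (merge (consumed J) (current J) (x, y))))"

definition initial :: "'n set \<Rightarrow> bool" where
  "initial J \<longleftrightarrow> J \<subseteq> K \<and> (\<forall>c\<in>J. \<forall>c'\<in>K. rank c' < rank c \<longrightarrow> c' \<in> J)"

lemma initial_insertD:
  assumes J: "initial (insert c J)" and c: "c \<notin> J" and top: "\<And>x. x \<in> J \<Longrightarrow> rank x \<le> rank c"
  shows "initial J" "c \<in> K" "{c' \<in> K. rank c' < rank c} \<subseteq> J"
  using assms inj_rank unfolding initial_def inj_on_def by (fastforce)+

context
  fixes c J assumes J: "initial J" and c: "c \<in> K" "c \<notin> J" and below: "{c' \<in> K. rank c' < rank c} \<subseteq> J"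
begin

lemma In_current: "In c \<subseteq> current J"
proof -
  have "In c \<inter> consumed J = {}"
    using In_disjoint c J unfolding consumed_def initial_def by blast
  moreover have "In c \<subseteq> A \<union> \<Union> (Out ` J)" using In_available[OF c(1)] below by blast
  ultimately show ?thesis unfolding current_def by blast
qed

lemma consumed_available: "consumed J \<subseteq> A \<union> \<Union> (Out ` J)"
proof
  fix w assume "w \<in> consumed J"
  then obtain b where b: "b \<in> J" "w \<in> In b" unfolding consumed_def by blast
  then have "w \<in> A \<union> \<Union> (Out ` {c' \<in> K. rank c' < rank b})" using In_available J unfolding initial_def by blast
  then show "w \<in> A \<union> \<Union> (Out ` J)" using J b(1) unfolding initial_def by blast
qed

lemma Out_fresh: "Out c \<inter> (A \<union> \<Union> (Out ` J)) = {}"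
  using Out_disjoint Out_initial c J unfolding initial_def by blast

lemma current_insert: "current (insert c J) = (current J - In c) \<union> Out c"
  using In_current consumed_available Out_fresh unfolding current_def consumed_def by blast

lemma consumed_insert: "consumed (insert c J) = consumed J \<union> In c"
  unfolding consumed_def by blast

lemma consumed_In: "consumed J \<inter> In c = {}"
  using In_current unfolding current_def by blast

lemma state_insert:
  "state \<psi> (insert c J) y =
     (\<Sum>i\<in>configs d (In c). S c (merge (In c) (Out c) (i, y)) * state \<psi> J (merge (In c) (current J - In c) (i, y)))"
proof -
  let ?U = "consumed J" and ?V = "current J" and ?I = "In c" and ?O = "Out c"
  \<comment> \<open>\<open>?m\<close> is the configuration with the wires \<open>In c\<close>
    counted as consumed, \<open>?l\<close> the one before \<open>c\<close> acts. They agree on every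
    wire that exists before \<open>c\<close>, which is all that \<open>\<psi>\<close> and the older
    tensors see.\<close>
  let ?m = "\<lambda>x i. merge (?U \<union> ?I) ((?V - ?I) \<union> ?O) (merge ?U ?I (x, i), y)"
  let ?l = "\<lambda>x i. merge ?U ?V (x, merge ?I (?V - ?I) (i, y))"
  have old: "?m x i w = ?l x i w" if "w \<in> A \<union> \<Union> (Out ` J)" for x i w
    using that In_current Out_fresh unfolding merge_def current_def by auto
  have psi: "restrict (?m x i) A = restrict (?l x i) A" for x i
    by (rule restrict_ext) (use old in blast)
  have SJ: "S b (?m x i) = S b (?l x i)" if "b \<in> J" for b x i
  proof (rule S_local)
    show "b \<in> K" using that J unfolding initial_def by blast
    show "?m x i w = ?l x i w" if "w \<in> In b \<union> Out b" for w
    proof (rule old)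
      show "w \<in> A \<union> \<Union> (Out ` J)"
        using \<open>b \<in> J\<close> that consumed_available unfolding consumed_def by blast
    qed
  qed
  have Sc: "S c (?m x i) = S c (merge ?I ?O (i, y))" for x i
    by (rule S_local[OF c(1)]) (use In_current Out_fresh consumed_available consumed_In in \<open>auto simp: merge_def\<close>)
  have fin: "finite J" using J finite_nodes finite_subset unfolding initial_def by blast
  have "state \<psi> (insert c J) y = (\<Sum>x\<in>configs d ?U. \<Sum>i\<in>configs d ?I.
     \<psi> (restrict (?m x i) A) * (\<Prod>b\<in>insert c J. S b (?m x i)))"
    unfolding state_def consumed_insert current_insert by (rule sum_configs_Un[OF consumed_In])
  also have "\<dots> = (\<Sum>x\<in>configs d ?U. \<Sum>i\<in>configs d ?I.
     S c (merge ?I ?O (i, y)) * (\<psi> (restrict (?l x i) A) * (\<Prod>b\<in>J. S b (?l x i))))"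
    using fin c(2) by (intro sum.cong HOL.refl) (simp add: psi SJ Sc)
  also have "\<dots> = (\<Sum>i\<in>configs d ?I. \<Sum>x\<in>configs d ?U.
     S c (merge ?I ?O (i, y)) * (\<psi> (restrict (?l x i) A) * (\<Prod>b\<in>J. S b (?l x i))))"
    by (rule sum.swap)
  finally show ?thesis unfolding state_def by (simp add: sum_distrib_left)
qed

text \<open>The node acts as \<open>S c\<close> tensored with the identity on the spectator wires
  \<open>current J - In c\<close>. For each spectator configuration the squared norm is scaled by
  the same \<open>k\<close>, and the squares add up.\<close>

lemma state_insert_norm:
  "\<exists>k>0. \<forall>\<psi>. (tnorm d (current (insert c J)) (state \<psi> (insert c J)))\<^sup>2 = k * (tnorm d (current J) (state \<psi> J))\<^sup>2"
proof -
  let ?V = "current J" and ?I = "In c" and ?O = "Out c"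
  obtain k where k: "k > 0" "\<And>\<phi>. (tnorm d ?O (tensor_map d ?I ?O (S c) \<phi>))\<^sup>2 = k * (tnorm d ?I \<phi>)\<^sup>2"
    using S_isometric[OF c(1)] by blast
  have VO: "(?V - ?I) \<inter> ?O = {}" using Out_fresh unfolding current_def by blast
  have IO: "?I \<inter> ?O = {}" using In_current Out_fresh unfolding current_def by blast
  have "(tnorm d (current (insert c J)) (state \<psi> (insert c J)))\<^sup>2 = k * (tnorm d ?V (state \<psi> J))\<^sup>2" for \<psi>
  proof -
    have m1: "S c (merge ?I ?O (i, merge (?V - ?I) ?O (a, y))) = S c (merge ?I ?O (i, y))" for i a y
      using VO by (intro S_local[OF c(1)]) (auto simp: merge_def)
    have m2: "merge ?I (?V - ?I) (i, merge (?V - ?I) ?O (a, y)) = merge ?I (?V - ?I) (i, a)" for i a y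
      by (auto simp: merge_def)
    have st: "state \<psi> (insert c J) (merge (?V - ?I) ?O (a, y)) =
        tensor_map d ?I ?O (S c) (\<lambda>i. state \<psi> J (merge ?I (?V - ?I) (i, a))) y" for a y
      unfolding state_insert tensor_map_def by (simp add: m1 m2)
    have "(tnorm d (current (insert c J)) (state \<psi> (insert c J)))\<^sup>2 =
        (\<Sum>a\<in>configs d (?V - ?I). \<Sum>y\<in>configs d ?O. (cmod (state \<psi> (insert c J) (merge (?V - ?I) ?O (a, y))))\<^sup>2)"
      unfolding tnorm_square current_insert by (rule sum_configs_Un[OF VO])
    also have "\<dots> = (\<Sum>a\<in>configs d (?V - ?I).
        (tnorm d ?O (tensor_map d ?I ?O (S c) (\<lambda>i. state \<psi> J (merge ?I (?V - ?I) (i, a)))))\<^sup>2)"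
      unfolding tnorm_square st ..
    also have "\<dots> = k * (\<Sum>a\<in>configs d (?V - ?I). \<Sum>i\<in>configs d ?I. (cmod (state \<psi> J (merge ?I (?V - ?I) (i, a))))\<^sup>2)"
      unfolding k(2) by (simp only: tnorm_square sum_distrib_left)
    also have "\<dots> = k * (\<Sum>w\<in>configs d (?I \<union> (?V - ?I)). (cmod (state \<psi> J w))\<^sup>2)"
      by (subst sum.swap, subst sum_configs_Un) auto
    also have "?I \<union> (?V - ?I) = ?V" using In_current by blast
    finally show ?thesis unfolding tnorm_square .
  qed
  then show ?thesis using k(1) by blast
qed

end

lemma state_norm:
  assumes "initial J"
  shows "\<exists>k>0. \<forall>\<psi>. (tnorm d (current J) (state \<psi> J))\<^sup>2 = k * (tnorm d A \<psi>)\<^sup>2"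
proof -
  have "finite J" using assms finite_nodes finite_subset unfolding initial_def by blast
  then show ?thesis using assms
  \<comment> \<open>Nodes are added in increasing rank, so that each intermediate set is again
    \<open>initial\<close>.\<close>
  proof (induction rule: finite_ranking_induct[where f = rank])
    case empty
    have "(\<Sum>x\<in>configs d A. (cmod (state \<psi> {} x))\<^sup>2) = (\<Sum>x\<in>configs d A. (cmod (\<psi> x))\<^sup>2)" for \<psi>
    proof (rule sum.cong)
      fix x assume "x \<in> configs d A"
      then have "restrict x A = x" unfolding configs_def by (metis PiE_restrict)
      \<comment> \<open>The constant \<open>undefined\<close> function is the single element of
        \<open>configs d {}\<close>, the index of the empty sum of consumed wires.\<close>
      moreover have "restrict (merge {} A (\<lambda>x. undefined, x)) A = restrict x A"
        by (auto simp: merge_def restrict_def)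
      ultimately show "(cmod (state \<psi> {} x))\<^sup>2 = (cmod (\<psi> x))\<^sup>2"
        unfolding state_def consumed_def current_def configs_def by simp
    qed simp
    then show ?case
      unfolding tnorm_square by (intro exI[of _ 1]) (simp add: current_def consumed_def)
  next
    case (insert c J)
    show ?case
    proof (cases "c \<in> J")
      case True
      then show ?thesis using insert by (simp add: insert_absorb)
    next
      case False
      note J = initial_insertD[OF insert.prems False insert.hyps(2)]
      obtain k where k: "k > 0" "\<And>\<psi>. (tnorm d (current J) (state \<psi> J))\<^sup>2 = k * (tnorm d A \<psi>)\<^sup>2"
        using insert.IH J(1) by blast
      obtain l where l: "l > 0" "\<And>\<psi>. (tnorm d (current (insert c J)) (state \<psi> (insert c J)))\<^sup>2
          = l * (tnorm d (current J) (state \<psi> J))\<^sup>2"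
        using state_insert_norm[OF J(1,2) False J(3)] by blast
      then show ?thesis using k by (intro exI[of _ "l * k"]) simp
    qed
  qed
qed

lemma network_norm:
  "\<exists>k>0. \<forall>\<psi>. (tnorm d (current K) (state \<psi> K))\<^sup>2 = k * (tnorm d A \<psi>)\<^sup>2"
  by (rule state_norm) (simp add: initial_def)

end

section \<open>Renaming the legs of a perfect tensor as wires\<close>

lemma sum_configs_image:
  assumes "inj_on f B"
  shows "(\<Sum>w\<in>configs d (f ` B). g (\<lambda>l\<in>B. w (f l))) = (\<Sum>j\<in>configs d B. g j)"
proof (rule sum.reindex_bij_betw)
  show "bij_betw (\<lambda>w. \<lambda>l\<in>B. w (f l)) (configs d (f ` B)) (configs d B)"
  proof (rule bij_betw_byWitness[where f' = "\<lambda>j. \<lambda>w\<in>f ` B. j (inv_into B f w)"])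
    show "\<forall>a\<in>configs d (f ` B). (\<lambda>w\<in>f ` B. (\<lambda>l\<in>B. a (f l)) (inv_into B f w)) = a"
      using assms by (auto simp: configs_def fun_eq_iff PiE_def extensional_def restrict_def inv_into_into f_inv_into_f)
    show "\<forall>a\<in>configs d B. (\<lambda>l\<in>B. (\<lambda>w\<in>f ` B. a (inv_into B f w)) (f l)) = a"
      using assms by (auto simp: configs_def fun_eq_iff PiE_def extensional_def restrict_def)
  qed (use assms in \<open>auto simp: configs_def PiE_def Pi_def extensional_def restrict_def\<close>)
qed

text \<open>An injective naming identifies configurations of wires with configurations of legs. The
  factor is \<open>1 / \<kappa>\<^sup>2\<close>, as \<open>\<kappa>\<close> normalises the map
  before norms are squared.\<close>

lemma perfect_tensor_relabelled:
  assumes T: "perfect_tensor d L T" and f: "inj_on f L"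
    and I: "I \<subseteq> L" "card I \<le> card (L - I)"
  shows "\<exists>k>0. \<forall>\<phi>. (tnorm d (f ` (L - I))
      (tensor_map d (f ` I) (f ` (L - I)) (\<lambda>w. T (\<lambda>l\<in>L. w (f l))) \<phi>))\<^sup>2 = k * (tnorm d (f ` I) \<phi>)\<^sup>2"
proof -
  let ?O = "L - I"
  obtain \<kappa> where \<kappa>: "\<kappa> > 0"
    "\<And>\<psi>. tnorm d ?O (\<lambda>y. complex_of_real \<kappa> * tensor_map d I ?O T \<psi> y) = tnorm d I \<psi>"
    using T I unfolding perfect_tensor_def is_isometry_def by metis
  have sq: "(tnorm d ?O (tensor_map d I ?O T \<psi>))\<^sup>2 = (1 / \<kappa>\<^sup>2) * (tnorm d I \<psi>)\<^sup>2" for \<psi>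
  proof -
    have "(tnorm d I \<psi>)\<^sup>2 = (tnorm d ?O (\<lambda>y. complex_of_real \<kappa> * tensor_map d I ?O T \<psi> y))\<^sup>2"
      using \<kappa>(2) by simp
    also have "\<dots> = \<kappa>\<^sup>2 * (tnorm d ?O (tensor_map d I ?O T \<psi>))\<^sup>2"
      unfolding tnorm_square by (simp add: norm_mult power_mult_distrib sum_distrib_left)
    finally show ?thesis using \<kappa>(1) by simp
  qed
  have fI: "inj_on f I" "inj_on f ?O" using f I inj_on_subset by blast+
  let ?pI = "\<lambda>w. \<lambda>l\<in>I. w (f l)" and ?pO = "\<lambda>w. \<lambda>l\<in>?O. w (f l)"
  have "(tnorm d (f ` ?O) (tensor_map d (f ` I) (f ` ?O) (\<lambda>w. T (\<lambda>l\<in>L. w (f l))) \<phi>))\<^sup>2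
      = (1 / \<kappa>\<^sup>2) * (tnorm d (f ` I) \<phi>)\<^sup>2" for \<phi>
  proof -
    define \<phi>' where "\<phi>' j = \<phi> (\<lambda>w\<in>f ` I. j (inv_into I f w))" for j
    have phi: "\<phi>' (?pI i) = \<phi> i" if "i \<in> configs d (f ` I)" for i
    proof -
      have "(\<lambda>w\<in>f ` I. ?pI i (inv_into I f w)) = i"
        using that by (auto simp: configs_def fun_eq_iff PiE_def extensional_def restrict_def
            inv_into_into f_inv_into_f)
      then show ?thesis unfolding \<phi>'_def by simp
    qed
    have mrg: "(\<lambda>l\<in>L. merge (f ` I) (f ` ?O) (i, y) (f l)) = merge I ?O (?pI i, ?pO y)" for i y :: "_ \<Rightarrow> nat"
      using f I(1) by (auto simp: merge_def fun_eq_iff inj_on_def restrict_def)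
    have tm: "tensor_map d (f ` I) (f ` ?O) (\<lambda>w. T (\<lambda>l\<in>L. w (f l))) \<phi> y = tensor_map d I ?O T \<phi>' (?pO y)" for y
    proof -
      have "tensor_map d (f ` I) (f ` ?O) (\<lambda>w. T (\<lambda>l\<in>L. w (f l))) \<phi> y =
          (\<Sum>i\<in>configs d (f ` I). T (merge I ?O (?pI i, ?pO y)) * \<phi>' (?pI i))"
        unfolding tensor_map_def by (rule sum.cong) (simp_all only: mrg phi)
      also have "\<dots> = tensor_map d I ?O T \<phi>' (?pO y)"
        unfolding tensor_map_def
        by (rule sum_configs_image[OF fI(1), where g = "\<lambda>j. T (merge I ?O (j, ?pO y)) * \<phi>' j"])
      finally show ?thesis .
    qed
    have "(tnorm d (f ` ?O) (tensor_map d (f ` I) (f ` ?O) (\<lambda>w. T (\<lambda>l\<in>L. w (f l))) \<phi>))\<^sup>2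
       = (tnorm d ?O (tensor_map d I ?O T \<phi>'))\<^sup>2"
      unfolding tnorm_square tm
      by (rule sum_configs_image[OF fI(2), where g = "\<lambda>y. (cmod (tensor_map d I ?O T \<phi>' y))\<^sup>2"])
    moreover have "(tnorm d (f ` I) \<phi>)\<^sup>2 = (tnorm d I \<phi>')\<^sup>2"
    proof -
      have "(tnorm d (f ` I) \<phi>)\<^sup>2 = (\<Sum>i\<in>configs d (f ` I). (cmod (\<phi>' (?pI i)))\<^sup>2)"
        unfolding tnorm_square by (rule sum.cong) (simp_all only: phi)
      also have "\<dots> = (tnorm d I \<phi>')\<^sup>2" unfolding tnorm_square
        by (rule sum_configs_image[OF fI(1), where g = "\<lambda>y. (cmod (\<phi>' y))\<^sup>2"])
      finally show ?thesis .
    qed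
    ultimately show ?thesis using sq by simp
  qed
  then show ?thesis using \<kappa>(1) by (intro exI[of _ "1 / \<kappa>\<^sup>2"]) simp
qed

text \<open>Lexicographic order: \<open>g\<close> numbers the elements injectively below
  \<open>n\<close>, so in \<open>h x * n + g x\<close> it only breaks ties of
  \<open>h\<close>.\<close>

lemma finite_rank_refining:
  fixes h :: "'a \<Rightarrow> nat"
  assumes "finite K"
  obtains rank :: "'a \<Rightarrow> nat" where "inj_on rank K"
    "\<And>x y. x \<in> K \<Longrightarrow> y \<in> K \<Longrightarrow> rank x < rank y \<Longrightarrow> h x \<le> h y"
proof -
  obtain g :: "'a \<Rightarrow> nat" and n where g: "g ` K = {i. i < n}" "inj_on g K"
    using finite_imp_inj_to_nat_seg[OF assms] by blast
  have gn: "g x < n" if "x \<in> K" for x using g(1) that by blast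
  have less: "h x * n + g x < h y * n + g y" if "x \<in> K" "h x < h y" for x y
  proof -
    have "h x * n + g x < Suc (h x) * n" using gn[OF that(1)] by simp
    also have "\<dots> \<le> h y * n" using that(2) by (intro mult_le_mono1) simp
    finally show ?thesis by simp
  qed
  show thesis
  proof (rule that[of "\<lambda>x. h x * n + g x"])
    show "inj_on (\<lambda>x. h x * n + g x) K"
    proof (rule inj_onI)
      fix x y assume xy: "x \<in> K" "y \<in> K" "h x * n + g x = h y * n + g y"
      then have "h x = h y" using less[of x y] less[of y x] by (metis less_irrefl linorder_less_linear)
      then show "x = y" using xy g(2) unfolding inj_on_def by simp
    qed
    show "h x \<le> h y" if "x \<in> K" "y \<in> K" "h x * n + g x < h y * n + g y" for x y
      using less[of y x] that by (meson leI less_asym)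
  qed
qed

section \<open>The truncated network as an ordered network\<close>

lemma (in bourdon) card_legs:
  assumes "c \<in> cells X"
  shows "finite (legs p q X c)" "card (legs p q X c) = (q - 1) + p * (q - 1)"
proof -
  have "card (legs p q X c) = card (Dangling ` {..<q - 1} :: 'c leg set) + card (Toward ` {c'. chamber_adj p X c c'})"
    unfolding legs_def by (rule card_Un_disjoint) (use card_neighbours(1)[OF assms] in auto)
  then show "card (legs p q X c) = (q - 1) + p * (q - 1)"
    using card_neighbours(2)[OF assms] by (simp add: card_image inj_on_def)
  show "finite (legs p q X c)" unfolding legs_def using card_neighbours(1)[OF assms] by simp
qed

lemma inj_wire_of: "inj_on (wire_of p X c0 \<Lambda> c) L"
proof (rule inj_onI)
  fix l l' assume "wire_of p X c0 \<Lambda> c l = wire_of p X c0 \<Lambda> c l'"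
  then show "l = l'" by (cases l; cases l') (auto simp: doubleton_eq_iff split: if_splits)
qed

theorem theorem3p6:
  fixes p q d \<Lambda> :: nat
    and X :: "('v, 'e, 'c) polygonal_complex"
    and c0 :: 'c
    and T :: "'c \<Rightarrow> ('c leg \<Rightarrow> nat) \<Rightarrow> complex"
  assumes "p \<ge> 5" and "odd p" and "q \<ge> 3" and "d \<ge> 2"
    and "bourdon_building p q X"
    and "c0 \<in> cells X"
    and "\<And>c. c \<in> cells X \<Longrightarrow> perfect_tensor d (legs p q X c) (T c)"
  shows "\<exists>\<kappa>>0. is_isometry d (bulk_wires p q X c0 \<Lambda>) (boundary_wires p X c0 \<Lambda>)
           (\<lambda>\<psi> y. complex_of_real \<kappa> * network_map p q d X c0 T \<Lambda> \<psi> y)"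
proof -
  interpret bourdon p q X using assms by unfold_locales
  define K where "K = kept p X c0 \<Lambda>"
  have finK: "finite K" unfolding K_def by (rule finite_kept[OF assms(6)])
  have KC: "c \<in> cells X" if "c \<in> K" for c using that unfolding K_def kept_def by blast
  obtain rank :: "'c \<Rightarrow> nat" where rank: "inj_on rank K"
    "\<And>x y. x \<in> K \<Longrightarrow> y \<in> K \<Longrightarrow> rank x < rank y \<Longrightarrow> layer p X c0 x \<le> layer p X c0 y"
    by (rule finite_rank_refining[OF finK]) (rule that)
  let ?w = "wire_of p X c0 \<Lambda>" and ?L = "legs p q X"
  \<comment> \<open>Inputs are fed by the bulk or by tensors contracted earlier; legs toward later
    or discarded chambers are outputs. Earlier in rank implies a layer not larger, which makes
    \<open>card_lower_neighbours\<close> applicable.\<close>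
  define In where "In c = Dangling ` {..<q - 1} \<union> Toward ` {c' \<in> K. chamber_adj p X c c' \<and> rank c' < rank c}" for c
  have In_wires: "?w c ` In c = {Bulk c k |k. k < q - 1} \<union>
      {Bond {c, c'} |c'. c' \<in> K \<and> chamber_adj p X c c' \<and> rank c' < rank c}" for c
    unfolding In_def K_def image_Un image_image by (auto simp: image_iff)
  have Out_legs: "?L c - In c = Toward ` {c' \<in> K. chamber_adj p X c c' \<and> rank c < rank c'} \<union>
      Toward ` {c'. chamber_adj p X c c' \<and> c' \<notin> K}" if "c \<in> K" for c
  proof -
    have ne: "rank c' < rank c \<or> rank c < rank c'" if "c' \<in> K" "chamber_adj p X c c'" for c'
      using that \<open>c \<in> K\<close> rank(1) unfolding inj_on_def chamber_adj_def by (metis nat_neq_iff)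
    show ?thesis unfolding legs_def In_def by (auto simp: image_iff dest: ne)
  qed
  have Out_wires: "?w c ` (?L c - In c) =
      {Bond {c, c'} |c'. c' \<in> K \<and> chamber_adj p X c c' \<and> rank c < rank c'} \<union>
      {Cut c c' |c'. chamber_adj p X c c' \<and> c' \<notin> K}" if "c \<in> K" for c
    unfolding Out_legs[OF that] K_def image_Un image_image by (auto simp: image_iff)
  have balance: "card (In c) \<le> card (?L c - In c)" if c: "c \<in> K" for c
  proof -
    have sub: "In c \<subseteq> ?L c" unfolding In_def legs_def by blast
    have "{c' \<in> K. chamber_adj p X c c' \<and> rank c' < rank c} \<subseteq>
        {c'. chamber_adj p X c c' \<and> layer p X c0 c' \<le> layer p X c0 c}"
      using rank(2)[OF _ c] by blast
    moreover have "finite {c'. chamber_adj p X c c' \<and> layer p X c0 c' \<le> layer p X c0 c}"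
      using card_neighbours(1)[OF KC[OF c]] by (rule rev_finite_subset) blast
    ultimately have "card {c' \<in> K. chamber_adj p X c c' \<and> rank c' < rank c} \<le> 2 * (q - 1)"
      using card_lower_neighbours[OF assms(6) KC[OF c]] card_mono order_trans by blast
    moreover have "card (In c) \<le> card (Dangling ` {..<q - 1} :: 'c leg set)
        + card (Toward ` {c' \<in> K. chamber_adj p X c c' \<and> rank c' < rank c})"
      unfolding In_def by (rule card_Un_le)
    ultimately have "card (In c) \<le> 3 * (q - 1)"
      by (simp add: card_image inj_on_def)
    \<comment> \<open>Twice the bound \<open>3 * (q - 1)\<close> on the inputs; this is where
      \<open>p + 1 \<ge> 6\<close> makes the inputs at most half of all legs.\<close>
    moreover have "6 * (q - 1) \<le> (q - 1) + p * (q - 1)"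
      using mult_le_mono1[OF assms(1), of "q - 1"] by simp
    ultimately show ?thesis
      using card_Diff_subset[OF finite_subset[OF sub card_legs(1)[OF KC[OF c]]] sub]
        card_legs(2)[OF KC[OF c]] by linarith
  qed
  interpret net: ordered_network d K "bulk_wires p q X c0 \<Lambda>" "\<lambda>c. ?w c ` In c"
    "\<lambda>c. ?w c ` (?L c - In c)" "\<lambda>c w. T c (\<lambda>l\<in>?L c. w (?w c l))" rank
  proof
    show "finite K" by (rule finK)
    show "inj_on rank K" by (rule rank(1))
    show "?w c ` In c \<inter> ?w c' ` In c' = {}" if "c \<in> K" "c' \<in> K" "c \<noteq> c'" for c c'
      unfolding In_wires using that by (auto simp: doubleton_eq_iff)
    show "?w c ` (?L c - In c) \<inter> ?w c' ` (?L c' - In c') = {}" if "c \<in> K" "c' \<in> K" "c \<noteq> c'" for c c'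
      unfolding Out_wires[OF that(1)] Out_wires[OF that(2)] using that by (auto simp: doubleton_eq_iff)
    show "?w c ` (?L c - In c) \<inter> bulk_wires p q X c0 \<Lambda> = {}" if "c \<in> K" for c
      unfolding Out_wires[OF that] bulk_wires_def by auto
    show "?w c ` In c \<subseteq> bulk_wires p q X c0 \<Lambda> \<union> \<Union> ((\<lambda>c. ?w c ` (?L c - In c)) ` {c' \<in> K. rank c' < rank c})"
      if c: "c \<in> K" for c
    proof
      fix w assume "w \<in> ?w c ` In c"
      then consider k where "w = Bulk c k" "k < q - 1"
        | c' where "w = Bond {c, c'}" "c' \<in> K" "chamber_adj p X c c'" "rank c' < rank c"
        unfolding In_wires by blast
      then show "w \<in> bulk_wires p q X c0 \<Lambda> \<union> \<Union> ((\<lambda>c. ?w c ` (?L c - In c)) ` {c' \<in> K. rank c' < rank c})"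
      proof cases
        case 1
        then show ?thesis using c unfolding bulk_wires_def K_def by blast
      next
        case 2
        have "w = Bond {c', c}" using 2(1) by (simp add: insert_commute)
        then have "w \<in> ?w c' ` (?L c' - In c')"
          unfolding Out_wires[OF 2(2)] using 2 c chamber_adj_sym by blast
        then show ?thesis using 2 by blast
      qed
    qed
    show "T c (\<lambda>l\<in>?L c. w (?w c l)) = T c (\<lambda>l\<in>?L c. w' (?w c l))"
      if "\<And>x. x \<in> ?w c ` In c \<union> ?w c ` (?L c - In c) \<Longrightarrow> w x = w' x" for c w w'
      by (rule arg_cong[where f = "T c"]) (rule restrict_ext, use that in blast)
    show "\<exists>k>0. \<forall>\<phi>. (tnorm d (?w c ` (?L c - In c))
        (tensor_map d (?w c ` In c) (?w c ` (?L c - In c)) (\<lambda>w. T c (\<lambda>l\<in>?L c. w (?w c l))) \<phi>))\<^sup>2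
        = k * (tnorm d (?w c ` In c) \<phi>)\<^sup>2" if c: "c \<in> K" for c
      by (rule perfect_tensor_relabelled[OF assms(7)[OF KC[OF c]] inj_wire_of _ balance[OF c]])
        (auto simp: In_def legs_def)
  qed
  let ?A = "bulk_wires p q X c0 \<Lambda>" and ?B = "bond_wires p X c0 \<Lambda>" and ?D = "boundary_wires p X c0 \<Lambda>"
  have AB: "?A \<inter> ?B = {}" "?A \<inter> ?D = {}" "?B \<inter> ?D = {}"
    unfolding bulk_wires_def bond_wires_def boundary_wires_def by auto
  \<comment> \<open>A bond is an unordered pair; the rank orients it, with the later chamber as its
    consumer.\<close>
  have bond: "\<exists>b\<in>K. \<exists>b'\<in>K. chamber_adj p X b b' \<and> rank b' < rank b \<and> {c, c'} = {b, b'}"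
    if "c \<in> K" "c' \<in> K" "chamber_adj p X c c'" for c c'
  proof -
    have "rank c \<noteq> rank c'" using that rank(1) unfolding inj_on_def chamber_adj_def by blast
    then show ?thesis using that chamber_adj_sym[of c c'] by (metis insert_commute nat_neq_iff)
  qed
  have In: "net.consumed K = (\<Union>c\<in>K. {Bulk c k |k. k < q - 1} \<union>
      {Bond {c, c'} |c'. c' \<in> K \<and> chamber_adj p X c c' \<and> rank c' < rank c})"
    unfolding net.consumed_def by (simp only: In_wires)
  have consumed: "net.consumed K = ?A \<union> ?B"
  proof
    show "net.consumed K \<subseteq> ?A \<union> ?B"
      unfolding In bulk_wires_def bond_wires_def K_def[symmetric] by blast
    show "?A \<union> ?B \<subseteq> net.consumed K"
    proof
      fix w assume "w \<in> ?A \<union> ?B"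
      then consider c k where "w = Bulk c k" "c \<in> K" "k < q - 1"
        | c c' where "w = Bond {c, c'}" "c \<in> K" "c' \<in> K" "chamber_adj p X c c'"
        unfolding bulk_wires_def bond_wires_def K_def by blast
      then show "w \<in> net.consumed K"
      proof cases
        case 2
        then show ?thesis using bond[OF 2(2-4)] unfolding In by blast
      qed (unfold In, blast)
    qed
  qed
  \<comment> \<open>Adjacent layers differ by at most one, so a discarded neighbour of a kept
    chamber lies exactly in layer \<open>\<Lambda> + 1\<close>.\<close>
  have cut: "layer p X c0 c' = \<Lambda> + 1 \<longleftrightarrow> c' \<notin> K" if "c \<in> K" "chamber_adj p X c c'" for c c'
    using layer_adj[OF assms(6) that(2)] that unfolding K_def kept_def chamber_adj_def by auto
  have D: "?D = {Cut c c' |c c'. c \<in> K \<and> chamber_adj p X c c' \<and> c' \<notin> K}"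
    unfolding boundary_wires_def K_def[symmetric] using cut by blast
  have Out: "\<Union> ((\<lambda>c. ?w c ` (?L c - In c)) ` K) = (\<Union>c\<in>K.
      {Bond {c, c'} |c'. c' \<in> K \<and> chamber_adj p X c c' \<and> rank c < rank c'} \<union>
      {Cut c c' |c'. chamber_adj p X c c' \<and> c' \<notin> K})"
    using Out_wires by simp
  have current: "net.current K = ?D"
  proof -
    have "(\<Union>c\<in>K. {Bond {c, c'} |c'. c' \<in> K \<and> chamber_adj p X c c' \<and> rank c < rank c'} \<union>
      {Cut c c' |c'. chamber_adj p X c c' \<and> c' \<notin> K}) \<subseteq> ?B \<union> ?D"
      unfolding D bond_wires_def K_def[symmetric] by blast
    moreover have "?D \<subseteq> (\<Union>c\<in>K. {Bond {c, c'} |c'. c' \<in> K \<and> chamber_adj p X c c' \<and> rank c < rank c'} \<union>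
      {Cut c c' |c'. chamber_adj p X c c' \<and> c' \<notin> K})"
      unfolding D by blast
    ultimately show ?thesis unfolding net.current_def consumed Out using AB by blast
  qed
  have map: "network_map p q d X c0 T \<Lambda> \<psi> y = net.state \<psi> K y" for \<psi> y
  proof -
    let ?m = "\<lambda>x z. merge (?A \<union> ?B) ?D (merge ?A ?B (x, z), y)"
    \<comment> \<open>The network groups bulk with boundary and sums over bonds, whereas the ordered
      contraction groups bulk with bonds as consumed wires.\<close>
    have m: "merge (?A \<union> ?D) ?B (merge ?A ?D (x, y), z) = ?m x z" for x z
      using AB by (auto simp: merge_def fun_eq_iff)
    have r: "restrict (?m x z) ?A = x" if "x \<in> configs d ?A" for x z
      using that by (auto simp: merge_def fun_eq_iff configs_def PiE_def extensional_def)
    have "net.state \<psi> K y = (\<Sum>x\<in>configs d ?A. \<Sum>z\<in>configs d ?B.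
        \<psi> (restrict (?m x z) ?A) * (\<Prod>c\<in>K. T c (\<lambda>l\<in>?L c. ?m x z (?w c l))))"
      unfolding net.state_def consumed current by (rule sum_configs_Un[OF AB(1)])
    also have "\<dots> = (\<Sum>x\<in>configs d ?A. \<Sum>z\<in>configs d ?B.
        \<psi> x * (\<Prod>c\<in>K. T c (\<lambda>l\<in>?L c. ?m x z (?w c l))))"
      by (intro sum.cong HOL.refl) (simp only: r)
    also have "\<dots> = network_map p q d X c0 T \<Lambda> \<psi> y"
      unfolding network_map_def tensor_map_def network_tensor_def K_def[symmetric] m
      by (simp add: sum_distrib_left mult.commute)
    finally show ?thesis by simp
  qed
  obtain k where k: "k > 0" "\<And>\<psi>. (tnorm d ?D (network_map p q d X c0 T \<Lambda> \<psi>))\<^sup>2 = k * (tnorm d ?A \<psi>)\<^sup>2"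
    using net.network_norm unfolding current map[symmetric, abs_def] by blast
  \<comment> \<open>The square root appears because \<open>k\<close> scales squared norms.\<close>
  define \<kappa> where "\<kappa> = 1 / sqrt k"
  have "\<kappa> > 0" "\<kappa>\<^sup>2 * k = 1" using k(1) unfolding \<kappa>_def by (simp_all add: power_divide)
  moreover have "tnorm d ?D (\<lambda>y. complex_of_real \<kappa> * network_map p q d X c0 T \<Lambda> \<psi> y) = tnorm d ?A \<psi>" for \<psi>
  proof (rule power2_eq_imp_eq)
    have "(tnorm d ?D (\<lambda>y. complex_of_real \<kappa> * network_map p q d X c0 T \<Lambda> \<psi> y))\<^sup>2 =
        \<kappa>\<^sup>2 * (tnorm d ?D (network_map p q d X c0 T \<Lambda> \<psi>))\<^sup>2"
      unfolding tnorm_square by (simp add: norm_mult power_mult_distrib sum_distrib_left)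
    then show "(tnorm d ?D (\<lambda>y. complex_of_real \<kappa> * network_map p q d X c0 T \<Lambda> \<psi> y))\<^sup>2 = (tnorm d ?A \<psi>)\<^sup>2"
      using \<open>\<kappa>\<^sup>2 * k = 1\<close> by (simp add: k(2) mult.assoc[symmetric])
  qed (rule tnorm_nonneg)+
  moreover have "network_map p q d X c0 T \<Lambda> (\<lambda>x. a * \<psi> x + b * \<phi> x) y =
      a * network_map p q d X c0 T \<Lambda> \<psi> y + b * network_map p q d X c0 T \<Lambda> \<phi> y" for a b \<psi> \<phi> y
    unfolding network_map_def tensor_map_def
    by (simp add: sum_distrib_left sum.distrib algebra_simps)
  ultimately show ?thesis
    unfolding is_isometry_def by (intro exI[of _ \<kappa>]) (simp add: algebra_simps)
qed

end
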